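(* Let $X$ and $Y$ be rooted, pseudo-regular, visual trees of bounded degree with the graph metric, and let $V_X$ and $V_Y$ be their vertex sets (with the restricted metrics). Then $V_X$ and $V_Y$ are bilipschitz equivalent.
   Context: A tree is viewed as a metric space by taking each edge to be isometric to an interval of length $1$ and using the induced path metric $d$ (the graph metric); the distance between two vertices is the fewest number of edges required to connect them. Rooted tree $(T,v_0)$: a tree $T$ with a distinguished vertex $v_0$. Visual: a rooted tree $(T,v_0)$ with vertex set $V$ is visual if there is a constant $C>0$ such that for every vertex $v\in V$ there is an infinite geodesic ray $I$ with endpoint $v_0$ such that $d(v,I)\le C$. Bounded degree: there is $\mu>0$ such that every vertex $v$ has $\deg(v)\le\mu$, where $\deg(v)$ is the number of edges emanating from $v$. Pseudo-regular: for $x,y\in T$ let $[xy]$ denote the unique geodesic connecting $x$ to $y$; for $v,x\in T$ let $T_x^v=\{y\in T: x\in[vy]\}$; let $S(v_0,t)$ be the sphere of radius $t$ centered at $v_0$ in the graph metric. Given $K>0$, a rooted, visual tree $(T,v_0)$ is $K$-pseudo-regular if for every $t\in\mathbb N$ and every $a\in S(v_0,t)$ there exist at least two points in $S(v_0,t+K)\cap T_a^{v_0}$. It is pseudo-regular if it is $K$-pseudo-regular for some $K$. Bilipschitz equivalence: a bijection $g\colon (A,d_A)\to(B,d_B)$ between metric spaces for which there is $C>0$ with $\frac1C d_A(x,x')\le d_B(g(x),g(x'))\le C d_A(x,x')$ for all $x,x'\in A$. Two spaces are bilipschitz equivalent if such a bijection exists. *)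

theory Defs
  imports "HOL-Analysis.Analysis"
begin

section \<open>Trees\<close>

text \<open>
  A graph is given by its vertex set \<open>V\<close> and its set \<open>E\<close> of edges, each edge being the
  two-element set of its endpoints. Both sets may be infinite.
\<close>

definition simple_graph :: "'a set \<Rightarrow> 'a set set \<Rightarrow> bool" where
  "simple_graph V E \<longleftrightarrow> (\<forall>e\<in>E. e \<subseteq> V \<and> card e = 2)"

definition walk :: "'a set \<Rightarrow> 'a set set \<Rightarrow> 'a list \<Rightarrow> bool" where
  "walk V E p \<longleftrightarrow> p \<noteq> [] \<and> set p \<subseteq> V \<and> successively (\<lambda>u w. {u, w} \<in> E) p"

definition connected_graph :: "'a set \<Rightarrow> 'a set set \<Rightarrow> bool" where
  "connected_graph V E \<longleftrightarrow> (\<forall>u\<in>V. \<forall>w\<in>V. \<exists>p. walk V E p \<and> hd p = u \<and> last p = w)"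

text \<open>A cycle is listed without repeating its first vertex at the end.\<close>

definition graph_cycle :: "'a set \<Rightarrow> 'a set set \<Rightarrow> 'a list \<Rightarrow> bool" where
  "graph_cycle V E p \<longleftrightarrow> walk V E p \<and> distinct p \<and> 3 \<le> length p \<and> {last p, hd p} \<in> E"

definition tree :: "'a set \<Rightarrow> 'a set set \<Rightarrow> bool" where
  "tree V E \<longleftrightarrow>
     simple_graph V E \<and> V \<noteq> {} \<and> connected_graph V E \<and> (\<nexists>p. graph_cycle V E p)"

definition rooted_tree :: "'a set \<Rightarrow> 'a set set \<Rightarrow> 'a \<Rightarrow> bool" where
  "rooted_tree V E v\<^sub>0 \<longleftrightarrow> tree V E \<and> v\<^sub>0 \<in> V"

text \<open>Finiteness is required explicitly because \<open>card\<close> of an infinite set is \<open>0\<close>.\<close>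

definition bounded_degree :: "'a set \<Rightarrow> 'a set set \<Rightarrow> bool" where
  "bounded_degree V E \<longleftrightarrow>
     (\<exists>\<mu>::real. \<mu> > 0 \<and> (\<forall>v\<in>V. finite {e\<in>E. v \<in> e} \<and> real (card {e\<in>E. v \<in> e}) \<le> \<mu>))"

section \<open>The metric space of a graph\<close>

text \<open>
  The graph with its edges filled in is realised in barycentric coordinates: a point is a
  function \<open>x\<close> from vertices to reals, the point of the edge \<open>{a, b}\<close> at distance \<open>s\<close>
  from \<open>a\<close> having \<open>x a = 1 - s\<close> and \<open>x b = s\<close>.
\<close>

definition vertex_point :: "'a \<Rightarrow> 'a \<Rightarrow> real" where
  "vertex_point v = indicator {v}"

definition edge_points :: "'a set \<Rightarrow> ('a \<Rightarrow> real) set" where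
  "edge_points e = {x. (\<forall>u. 0 \<le> x u) \<and> (\<forall>u. u \<notin> e \<longrightarrow> x u = 0) \<and> (\<Sum>u\<in>e. x u) = 1}"

definition graph_points :: "'a set \<Rightarrow> 'a set set \<Rightarrow> ('a \<Rightarrow> real) set" where
  "graph_points V E = vertex_point ` V \<union> (\<Union>e\<in>E. edge_points e)"

text \<open>
  For \<open>x, y\<close> on the edge \<open>e = {a, b}\<close> both summands are equal, so that this is
  \<open>\<bar>x a - y a\<bar>\<close> and makes the edge isometric to the unit interval.
\<close>

definition edge_dist :: "'a set \<Rightarrow> ('a \<Rightarrow> real) \<Rightarrow> ('a \<Rightarrow> real) \<Rightarrow> real" where
  "edge_dist e x y = (\<Sum>u\<in>e. \<bar>x u - y u\<bar>) / 2"

text \<open>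
  \<open>path_length E x y l\<close>: some path from \<open>x\<close> to \<open>y\<close>, composed of finitely many segments
  each inside a closed edge, has length \<open>l\<close>.
\<close>

inductive path_length :: "'a set set \<Rightarrow> ('a \<Rightarrow> real) \<Rightarrow> ('a \<Rightarrow> real) \<Rightarrow> real \<Rightarrow> bool"
  for E :: "'a set set" where
  trivial: "path_length E x x 0"
| segment: "\<lbrakk>e \<in> E; x \<in> edge_points e; y \<in> edge_points e; path_length E y z l\<rbrakk>
    \<Longrightarrow> path_length E x z (edge_dist e x y + l)"

text \<open>
  The infimum of an empty set of reals is unspecified; the value for unreachable pairs never
  matters, as it only concerns functions that are not points of the connected graph at hand.
\<close>

definition path_dist :: "'a set set \<Rightarrow> ('a \<Rightarrow> real) \<Rightarrow> ('a \<Rightarrow> real) \<Rightarrow> real" where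
  "path_dist E x y = (if \<exists>l. path_length E x y l then Inf {l. path_length E x y l} else 0)"

section \<open>Geodesics\<close>

definition isometric_on :: "'p set \<Rightarrow> ('p \<Rightarrow> 'p \<Rightarrow> real) \<Rightarrow> real set \<Rightarrow> (real \<Rightarrow> 'p) \<Rightarrow> bool" where
  "isometric_on M d I \<gamma> \<longleftrightarrow> \<gamma> ` I \<subseteq> M \<and> (\<forall>s\<in>I. \<forall>t\<in>I. d (\<gamma> s) (\<gamma> t) = \<bar>s - t\<bar>)"

text \<open>The union of all geodesics from \<open>x\<close> to \<open>y\<close>; in a tree there is exactly one.\<close>

definition geodesic_segment :: "'p set \<Rightarrow> ('p \<Rightarrow> 'p \<Rightarrow> real) \<Rightarrow> 'p \<Rightarrow> 'p \<Rightarrow> 'p set" where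
  "geodesic_segment M d x y =
     \<Union>{\<gamma> ` {0..d x y} |\<gamma>. isometric_on M d {0..d x y} \<gamma> \<and> \<gamma> 0 = x \<and> \<gamma> (d x y) = y}"

definition geodesic_ray_from :: "'p set \<Rightarrow> ('p \<Rightarrow> 'p \<Rightarrow> real) \<Rightarrow> 'p \<Rightarrow> 'p set \<Rightarrow> bool" where
  "geodesic_ray_from M d x I \<longleftrightarrow> (\<exists>\<rho>. isometric_on M d {0..} \<rho> \<and> \<rho> 0 = x \<and> I = \<rho> ` {0..})"

definition dist_to_set :: "('p \<Rightarrow> 'p \<Rightarrow> real) \<Rightarrow> 'p \<Rightarrow> 'p set \<Rightarrow> real" where
  "dist_to_set d x I = (INF y\<in>I. d x y)"

definition metric_sphere :: "'p set \<Rightarrow> ('p \<Rightarrow> 'p \<Rightarrow> real) \<Rightarrow> 'p \<Rightarrow> real \<Rightarrow> 'p set" where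
  "metric_sphere M d x r = {y\<in>M. d x y = r}"

definition shadow :: "'p set \<Rightarrow> ('p \<Rightarrow> 'p \<Rightarrow> real) \<Rightarrow> 'p \<Rightarrow> 'p \<Rightarrow> 'p set" where
  "shadow M d v x = {y\<in>M. x \<in> geodesic_segment M d v y}"

section \<open>Visual and pseudo-regular rooted trees\<close>

definition visual :: "'a set \<Rightarrow> 'a set set \<Rightarrow> 'a \<Rightarrow> bool" where
  "visual V E v\<^sub>0 \<longleftrightarrow> rooted_tree V E v\<^sub>0 \<and>
     (\<exists>C>0. \<forall>v\<in>V. \<exists>I. geodesic_ray_from (graph_points V E) (path_dist E) (vertex_point v\<^sub>0) I \<and>
        dist_to_set (path_dist E) (vertex_point v) I \<le> C)"

text \<open>\<open>K\<close> may be any positive real, so the two points need not be vertices.\<close>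

definition K_pseudo_regular :: "real \<Rightarrow> 'a set \<Rightarrow> 'a set set \<Rightarrow> 'a \<Rightarrow> bool" where
  "K_pseudo_regular K V E v\<^sub>0 \<longleftrightarrow> K > 0 \<and> visual V E v\<^sub>0 \<and>
     (let T = graph_points V E; d = path_dist E; o\<^sub>T = vertex_point v\<^sub>0 in
       \<forall>t::nat. \<forall>a \<in> metric_sphere T d o\<^sub>T (real t).
         \<exists>y z. y \<noteq> z \<and> {y, z} \<subseteq> metric_sphere T d o\<^sub>T (real t + K) \<inter> shadow T d o\<^sub>T a)"

definition pseudo_regular :: "'a set \<Rightarrow> 'a set set \<Rightarrow> 'a \<Rightarrow> bool" where
  "pseudo_regular V E v\<^sub>0 \<longleftrightarrow> (\<exists>K. K_pseudo_regular K V E v\<^sub>0)"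

section \<open>Bilipschitz equivalence\<close>

definition bilipschitz_equivalent ::
  "'p set \<Rightarrow> ('p \<Rightarrow> 'p \<Rightarrow> real) \<Rightarrow> 'q set \<Rightarrow> ('q \<Rightarrow> 'q \<Rightarrow> real) \<Rightarrow> bool" where
  "bilipschitz_equivalent A d\<^sub>A B d\<^sub>B \<longleftrightarrow>
     (\<exists>g. bij_betw g A B \<and>
       (\<exists>C>0. \<forall>x\<in>A. \<forall>x'\<in>A.
          1 / C * d\<^sub>A x x' \<le> d\<^sub>B (g x) (g x') \<and> d\<^sub>B (g x) (g x') \<le> C * d\<^sub>A x x'))"

section \<open>The path metric is a metric and extends the graph distance\<close>

lemma simple_graphE:
  assumes "simple_graph V E" "e \<in> E"
  obtains a b where "e = {a, b}" "a \<noteq> b" "a \<in> V" "b \<in> V"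
  using assms unfolding simple_graph_def by (metis card_2_iff insert_subset)

lemma edge_points_pair:
  assumes "a \<noteq> b"
  shows "x \<in> edge_points {a, b} \<longleftrightarrow>
    0 \<le> x a \<and> 0 \<le> x b \<and> x a + x b = 1 \<and> (\<forall>u. u \<noteq> a \<longrightarrow> u \<noteq> b \<longrightarrow> x u = 0)"
proof -
  have sum: "(\<Sum>u\<in>{a, b}. x u) = x a + x b" using assms by simp
  have nonneg: "0 \<le> x u"
    if "0 \<le> x a" "0 \<le> x b" "\<forall>u. u \<noteq> a \<longrightarrow> u \<noteq> b \<longrightarrow> x u = 0" for u
    using that by (cases "u = a \<or> u = b") auto
  show ?thesis
  proof
    assume "x \<in> edge_points {a, b}"
    then show "0 \<le> x a \<and> 0 \<le> x b \<and> x a + x b = 1 \<and> (\<forall>u. u \<noteq> a \<longrightarrow> u \<noteq> b \<longrightarrow> x u = 0)"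
      unfolding edge_points_def mem_Collect_eq sum by blast
  next
    assume "0 \<le> x a \<and> 0 \<le> x b \<and> x a + x b = 1 \<and> (\<forall>u. u \<noteq> a \<longrightarrow> u \<noteq> b \<longrightarrow> x u = 0)"
    then show "x \<in> edge_points {a, b}"
      unfolding edge_points_def mem_Collect_eq sum using nonneg by blast
  qed
qed

lemma edge_dist_pair:
  assumes "a \<noteq> b" "x \<in> edge_points {a, b}" "y \<in> edge_points {a, b}"
  shows "edge_dist {a, b} x y = \<bar>x a - y a\<bar>" "edge_dist {a, b} x y = \<bar>x b - y b\<bar>"
  using assms by (auto simp: edge_dist_def edge_points_pair)

lemma edge_dist_nonneg: "0 \<le> edge_dist e x y"
  by (simp add: edge_dist_def sum_nonneg)

lemma edge_dist_commute: "edge_dist e x y = edge_dist e y x"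
  by (simp add: edge_dist_def abs_minus_commute)

lemma vertex_point_in_edge_points:
  assumes "a \<noteq> b"
  shows "vertex_point a \<in> edge_points {a, b}" "vertex_point b \<in> edge_points {a, b}"
  using assms by (auto simp: edge_points_pair vertex_point_def)

lemma inj_vertex_point: "inj vertex_point"
  by (rule injI) (metis vertex_point_def indicator_eq_1_iff singletonD singletonI)

lemma path_length_nonneg: "path_length E x y l \<Longrightarrow> 0 \<le> l"
  by (induction rule: path_length.induct) (auto intro: add_nonneg_nonneg edge_dist_nonneg)

lemma path_length_trans:
  "path_length E x y l \<Longrightarrow> path_length E y z m \<Longrightarrow> path_length E x z (l + m)"
  by (induction rule: path_length.induct) (auto simp: add.assoc intro: path_length.segment)

lemma path_length_edge:
  "e \<in> E \<Longrightarrow> x \<in> edge_points e \<Longrightarrow> y \<in> edge_points e \<Longrightarrow> path_length E x y (edge_dist e x y)"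
  using path_length.segment[OF _ _ _ path_length.trivial] by fastforce

lemma path_length_sym: "path_length E x y l \<Longrightarrow> path_length E y x l"
proof (induction rule: path_length.induct)
  case (segment e x y z l)
  then show ?case
    using path_length_trans[OF segment.IH path_length_edge[of e E y x]]
    by (simp add: edge_dist_commute add.commute)
qed (rule path_length.trivial)

lemma path_dist_lower:
  assumes "path_length E x y l" "\<And>l. path_length E x y l \<Longrightarrow> c \<le> l"
  shows "c \<le> path_dist E x y"
proof -
  have "c \<le> Inf {l. path_length E x y l}" using assms by (intro cInf_greatest) auto
  then show ?thesis using assms(1) by (auto simp: path_dist_def)
qed

lemma path_dist_upper:
  assumes "path_length E x y l"
  shows "path_dist E x y \<le> l"
proof -
  have "Inf {l. path_length E x y l} \<le> l"
    using assms by (intro cInf_lower) (auto intro!: bdd_belowI[of _ 0] path_length_nonneg)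
  then show ?thesis using assms by (auto simp: path_dist_def)
qed

lemma path_length_lipschitz:
  assumes "path_length E x y l"
    and "\<And>e x y. \<lbrakk>e \<in> E; x \<in> edge_points e; y \<in> edge_points e\<rbrakk> \<Longrightarrow> \<bar>f x - f y\<bar> \<le> edge_dist e x y"
  shows "\<bar>f x - f y\<bar> \<le> l"
  using assms(1)
proof (induction rule: path_length.induct)
  case (segment e x y z l)
  then show ?case using assms(2)[of e x y] by linarith
qed simp

lemma path_length_walk:
  assumes "simple_graph V E" "walk V E p"
  shows "path_length E (vertex_point (hd p)) (vertex_point (last p)) (real (length p - 1))"
  using assms(2)
proof (induction p)
  case (Cons v p)
  show ?case
  proof (cases p)
    case Nil
    then show ?thesis by (simp add: path_length.trivial)
  next
    case (Cons w q)
    with Cons.prems have vw: "{v, w} \<in> E" and p: "walk V E p"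
      by (auto simp: walk_def)
    then have "v \<noteq> w" using assms(1) by (auto simp: simple_graph_def)
    note vp = vertex_point_in_edge_points[OF this]
    have "edge_dist {v, w} (vertex_point v) (vertex_point w) = 1"
      using edge_dist_pair(1)[OF \<open>v \<noteq> w\<close> vp] \<open>v \<noteq> w\<close> by (simp add: vertex_point_def)
    then show ?thesis
      using path_length.segment[OF vw vp Cons.IH[OF p, unfolded Cons list.sel]] Cons by simp
  qed
qed (simp add: walk_def)

lemma path_length_exists:
  assumes "simple_graph V E" "connected_graph V E" "x \<in> graph_points V E" "y \<in> graph_points V E"
  shows "\<exists>l. path_length E x y l"
proof -
  have to_vertex: "\<exists>v\<in>V. \<exists>l. path_length E x (vertex_point v) l" if x: "x \<in> graph_points V E" for x
  proof -
    consider v where "v \<in> V" "x = vertex_point v" | e where "e \<in> E" "x \<in> edge_points e"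
      using x unfolding graph_points_def by auto
    then show ?thesis
    proof cases
      case 1
      then show ?thesis using path_length.trivial by blast
    next
      case 2
      obtain a b where ab: "e = {a, b}" "a \<noteq> b" "a \<in> V"
        using simple_graphE[OF assms(1) \<open>e \<in> E\<close>] by metis
      then have "vertex_point a \<in> edge_points e" using vertex_point_in_edge_points(1) by metis
      then show ?thesis
        using path_length_edge[OF \<open>e \<in> E\<close> \<open>x \<in> edge_points e\<close>] ab(3) by blast
    qed
  qed
  obtain u k where u: "u \<in> V" "path_length E x (vertex_point u) k" using to_vertex assms(3) by blast
  obtain w m where w: "w \<in> V" "path_length E y (vertex_point w) m" using to_vertex assms(4) by blast
  obtain p where "walk V E p" "hd p = u" "last p = w"
    using assms(2) u(1) w(1) unfolding connected_graph_def by blast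
  then show ?thesis
    using path_length_walk[OF assms(1)] path_length_trans u(2) path_length_sym[OF w(2)] by metis
qed

theorem Metric_space_path_dist:
  assumes "simple_graph V E" "connected_graph V E"
  shows "Metric_space (graph_points V E) (path_dist E)"
proof
  show "0 \<le> path_dist E x y" for x y :: "'a \<Rightarrow> real"
  proof (cases "\<exists>l. path_length E x y l")
    case True
    then show ?thesis using path_dist_lower path_length_nonneg by metis
  next
    case False
    then show ?thesis by (simp add: path_dist_def)
  qed
  show "path_dist E x y = path_dist E y x" for x y :: "'a \<Rightarrow> real"
  proof -
    have "path_length E x y = path_length E y x" by (intro ext) (metis path_length_sym)
    then show ?thesis by (simp add: path_dist_def)
  qed
next
  fix x y assume xy: "x \<in> graph_points V E" "y \<in> graph_points V E"
  show "path_dist E x y = 0 \<longleftrightarrow> x = y"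
  proof
    assume 0: "path_dist E x y = 0"
    show "x = y"
    proof
      fix u
      have "\<bar>x u - y u\<bar> \<le> edge_dist e x y"
        if e: "e \<in> E" "x \<in> edge_points e" "y \<in> edge_points e" for e x y
      proof -
        obtain a b where ab: "e = {a, b}" "a \<noteq> b"
          using simple_graphE[OF assms(1) \<open>e \<in> E\<close>] by metis
        consider "u = a" | "u = b" | "u \<noteq> a" "u \<noteq> b" by blast
        then show ?thesis
        proof cases
          case 1
          then show ?thesis using edge_dist_pair(1)[OF ab(2)] e ab(1) by simp
        next
          case 2
          then show ?thesis using edge_dist_pair(2)[OF ab(2)] e ab(1) by simp
        next
          case 3
          then have "u \<notin> e" using ab(1) by simp
          then have "x u = 0" "y u = 0" using e(2,3) unfolding edge_points_def by blast+
          then show ?thesis by (simp add: edge_dist_nonneg)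
        qed
      qed
      then have "\<bar>x u - y u\<bar> \<le> l" if "path_length E x y l" for l
        by (rule path_length_lipschitz[OF that, where f = "\<lambda>x. x u"])
      then have "\<bar>x u - y u\<bar> \<le> path_dist E x y"
        using path_length_exists[OF assms xy] path_dist_lower by blast
      then show "x u = y u" using 0 by simp
    qed
  next
    assume "x = y"
    then have "path_length E x y 0" by (simp add: path_length.trivial)
    then show "path_dist E x y = 0"
      using path_dist_upper[of E x y 0] path_dist_lower[of E x y 0 0] path_length_nonneg by force
  qed
next
  fix x y z
  assume xyz: "x \<in> graph_points V E" "y \<in> graph_points V E" "z \<in> graph_points V E"
  have "path_dist E x z - l \<le> path_dist E y z" if l: "path_length E x y l" for l
  proof -
    obtain m where "path_length E y z m" using path_length_exists[OF assms xyz(2,3)] ..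
    then show ?thesis
    proof (rule path_dist_lower)
      fix k assume "path_length E y z k"
      then have "path_dist E x z \<le> l + k" by (intro path_dist_upper path_length_trans[OF l])
      then show "path_dist E x z - l \<le> k" by simp
    qed
  qed
  moreover obtain n where "path_length E x y n" using path_length_exists[OF assms xyz(1,2)] ..
  ultimately have "path_dist E x z - path_dist E y z \<le> path_dist E x y"
    by (intro path_dist_lower[of E x y n]) (simp_all add: algebra_simps)
  then show "path_dist E x z \<le> path_dist E x y + path_dist E y z" by simp
qed

theorem path_dist_vertex_point:
  assumes "simple_graph V E" "connected_graph V E" "v \<in> V" "w \<in> V"
  shows "path_dist E (vertex_point v) (vertex_point w) =
    real (LEAST n. \<exists>p. walk V E p \<and> hd p = v \<and> last p = w \<and> length p = Suc n)"
proof -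
  define P where "P u n \<longleftrightarrow> (\<exists>p. walk V E p \<and> hd p = u \<and> last p = w \<and> length p = Suc n)" for u n
  define D where "D u = (LEAST n. P u n)" for u
  have ex: "P u (D u)" if "u \<in> V" for u
  proof -
    have "\<exists>p. walk V E p \<and> hd p = u \<and> last p = w"
      using assms(2,4) that by (simp add: connected_graph_def)
    then obtain p where p: "walk V E p" "hd p = u" "last p = w" by (elim exE conjE)
    moreover have "length p = Suc (length p - 1)" using p(1) by (simp add: walk_def)
    ultimately have "P u (length p - 1)" unfolding P_def by blast
    then show ?thesis unfolding D_def by (rule LeastI)
  qed
  have step: "D a \<le> Suc (D b)" if "{a, b} \<in> E" "a \<in> V" "b \<in> V" for a b
  proof -
    have "P b (D b)" using ex \<open>b \<in> V\<close> .
    then obtain p where p: "walk V E p" "hd p = b" "last p = w" "length p = Suc (D b)"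
      unfolding P_def by (elim exE conjE)
    have "walk V E (a # p)"
      using p(1) p(2) that(1,2) unfolding walk_def by (simp add: successively_Cons)
    moreover have "hd (a # p) = a" "last (a # p) = w" "length (a # p) = Suc (Suc (D b))"
      using p(1,3,4) by (simp_all add: walk_def)
    ultimately have "P a (Suc (D b))" unfolding P_def by blast
    then show ?thesis unfolding D_def by (rule Least_le)
  qed
  define f where "f x = (\<Sum>u | x u \<noteq> 0. x u * real (D u))" for x :: "'a \<Rightarrow> real"
  have f_edge: "f x = x a * real (D a) + x b * real (D b)"
    if "a \<noteq> b" "x \<in> edge_points {a, b}" for a b x
  proof -
    have "f x = (\<Sum>u\<in>{a, b}. x u * real (D u))"
      unfolding f_def using that by (intro sum.mono_neutral_left) (auto simp: edge_points_pair)
    then show ?thesis using that by simp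
  qed
  have f_lip: "\<bar>f x - f y\<bar> \<le> edge_dist e x y"
    if e: "e \<in> E" "x \<in> edge_points e" "y \<in> edge_points e" for e x y
  proof -
    obtain a b where ab: "e = {a, b}" "a \<noteq> b" "a \<in> V" "b \<in> V"
      using simple_graphE[OF assms(1) \<open>e \<in> E\<close>] by metis
    have xy: "x \<in> edge_points {a, b}" "y \<in> edge_points {a, b}" using e ab(1) by simp_all
    then have b: "x b = 1 - x a" "y b = 1 - y a" by (simp_all add: edge_points_pair[OF ab(2)])
    have "f x - f y = (x a - y a) * (real (D a) - real (D b))"
      unfolding f_edge[OF ab(2) xy(1)] f_edge[OF ab(2) xy(2)] b by (simp add: algebra_simps)
    moreover have "{a, b} \<in> E" "{b, a} \<in> E" using e(1) ab(1) by (simp_all add: insert_commute)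
    then have "D a \<le> Suc (D b)" "D b \<le> Suc (D a)" using step ab(3,4) by simp_all
    then have "\<bar>real (D a) - real (D b)\<bar> \<le> 1" by linarith
    ultimately have "\<bar>f x - f y\<bar> \<le> \<bar>x a - y a\<bar>"
      by (simp add: abs_mult mult_left_le)
    then show ?thesis using edge_dist_pair(1)[OF ab(2) xy] ab(1) by simp
  qed
  have f_vertex: "f (vertex_point u) = real (D u)" for u
  proof -
    have "{u'. vertex_point u u' \<noteq> 0} = {u}" by (auto simp: vertex_point_def indicator_def)
    then show ?thesis by (simp add: f_def vertex_point_def)
  qed
  have "walk V E [w] \<and> hd [w] = w \<and> last [w] = w \<and> length [w] = Suc 0"
    using assms(4) by (simp add: walk_def)
  then have "P w 0" unfolding P_def by (rule exI)
  then have "D w = 0" unfolding D_def by (rule Least_eq_0)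
  obtain p where p: "walk V E p" "hd p = v" "last p = w" "length p = Suc (D v)"
    using ex[OF assms(3)] unfolding P_def by (elim exE conjE)
  then have vw: "path_length E (vertex_point v) (vertex_point w) (real (D v))"
    using path_length_walk[OF assms(1) p(1)] by simp
  have "real (D v) \<le> l" if "path_length E (vertex_point v) (vertex_point w) l" for l
  proof -
    have "\<bar>f (vertex_point v) - f (vertex_point w)\<bar> \<le> l"
      using that f_lip by (rule path_length_lipschitz)
    then show ?thesis using f_vertex \<open>D w = 0\<close> by simp
  qed
  then have "path_dist E (vertex_point v) (vertex_point w) = real (D v)"
    by (intro order_antisym path_dist_upper[OF vw] path_dist_lower[OF vw])
  then show ?thesis unfolding D_def P_def .
qed

end

theory Submission
  imports Defs
begin

text \<open>
  Both vertex sets are compared with one model. Its points are the pairs \<open>(w, i)\<close> of a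
  binary word \<open>w\<close> and a slot \<open>i < L\<close>: the infinite binary tree with \<open>L\<close> vertices at every
  node. For all large \<open>L\<close> the vertex set of every tree in the theorem is bilipschitz equivalent
  to the model; taking the same \<open>L\<close> for the two trees and composing gives the result.

  To put a tree into this form, cut it into connected blocks of exactly \<open>L\<close> vertices. Starting
  from the top \<open>v\<close> of a block keep a list of waiting vertices, initially \<open>[v]\<close>, and \<open>L\<close> times
  remove its head and insert the children of the head. The removed vertices form the block, and
  those still waiting, the frontier, are the tops of the blocks below it. Pseudo-regularity says
  that a vertex has two descendants \<open>\<lceil>K\<rceil>\<close> generations further down, so once
  \<open>\<lceil>K\<rceil> \<le> L\<close> a block contains a branching and its frontier has at least two elements
  (\<open>length_frontier_ge_2\<close>); bounded degree bounds the size of the frontier from above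
  (\<open>length_frontier_le\<close>).

  A tree whose nodes all have between \<open>2\<close> and a bounded number of children is turned into the
  binary tree by the encoding with left children and right siblings. Each word carries a queue of
  block tops and owns the head of this queue. The letter \<open>False\<close> leads to the frontier of the
  owned block and \<open>True\<close> to the remaining siblings; if there are none, the frontier is itself
  divided between the two letters, which is where its two elements are needed. So every block is
  owned by exactly one word (\<open>bij_betw_place\<close>), all queues consist of siblings and stay
  within bounded diameter (\<open>d_place_relpow\<close>), and a child of a vertex is found a bounded number
  of letters away (\<open>place_child\<close>). As both metrics are determined by paths, bounds for adjacent
  vertices are enough (\<open>lipschitz_of_edges\<close>).

  It remains to extract children and descendants from the geometric hypotheses. Vertices
  are graded by their distance to the root, and acyclicity makes all edges join a vertex to its
  unique parent (\<open>neighbour_not_deeper_is_parent\<close>, \<open>edge_levels\<close>). Distances to points inside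
  edges are estimated from below by functions on the vertices that change by at most \<open>1\<close> along
  edges; one such function shows that a point whose geodesic from the root passes through \<open>v\<close>
  really lies below \<open>v\<close> (\<open>shadow_is_below\<close>).
\<close>

section \<open>Binary words\<close>

text \<open>
  Words grow at the front, and the relation is the adjacency of the binary tree made reflexive,
  so that its powers are the balls of the word metric.
\<close>

definition word_rel :: "bool list rel" where
  "word_rel = {(w, w'). w = w' \<or> (\<exists>b. w' = b # w \<or> w = b # w')}"

lemma word_rel_refl [simp]: "(w, w) \<in> word_rel" by (simp add: word_rel_def)

lemma sym_word_rel: "sym (word_rel ^^ k)"
proof (induction k)
  case (Suc k)
  have "sym word_rel" by (auto simp: sym_def word_rel_def)
  then have "(y, x) \<in> word_rel ^^ Suc k" if xy: "(x, y) \<in> word_rel ^^ Suc k" for x y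
  proof -
    obtain z where "(x, z) \<in> word_rel ^^ k" "(z, y) \<in> word_rel"
      using xy by (rule relpow_Suc_E)
    then have "(y, z) \<in> word_rel" "(z, x) \<in> word_rel ^^ k"
      using Suc \<open>sym word_rel\<close> by (auto dest: symD)
    then show ?thesis by (rule relpow_Suc_I2)
  qed
  then show ?case by (rule symI)
qed (simp add: sym_def)

lemma word_rel_mono: "k \<le> l \<Longrightarrow> (w, w') \<in> word_rel ^^ k \<Longrightarrow> (w, w') \<in> word_rel ^^ l"
  by (induction rule: dec_induct) auto

section \<open>Cutting a ramified tree into blocks\<close>

definition child_rel :: "('a \<Rightarrow> 'a list) \<Rightarrow> 'a rel" where
  "child_rel ch = {(u, w). w \<in> set (ch u)}"

text \<open>
  The combinatorial content of pseudo-regularity and bounded degree, for a tree given by the lists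
  of children. The grading \<open>dep\<close> excludes cycles. Outside the tree the lists may be taken empty, so
  that the rules about children carry no premise of membership in the tree.
\<close>

locale ramified_tree =
  fixes root :: 'a and ch :: "'a \<Rightarrow> 'a list" and dep :: "'a \<Rightarrow> nat" and m n :: nat
  assumes parent_unique: "v \<in> set (ch u) \<Longrightarrow> v \<in> set (ch u') \<Longrightarrow> u = u'"
    and dep_child: "v \<in> set (ch u) \<Longrightarrow> dep v = Suc (dep u)"
    and distinct_ch: "distinct (ch u)"
    and length_ch: "length (ch u) \<le> m"
    and ramified: "(root, v) \<in> (child_rel ch)\<^sup>* \<Longrightarrow>
      \<exists>x y. x \<noteq> y \<and> (v, x) \<in> (child_rel ch)\<^sup>* \<and> (v, y) \<in> (child_rel ch)\<^sup>* \<and>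
        dep x = dep v + n \<and> dep y = dep v + n"
begin

definition below :: "'a \<Rightarrow> 'a set" where
  "below v = {w. (v, w) \<in> (child_rel ch)\<^sup>*}"

lemma below_self [simp, intro]: "v \<in> below v"
  by (simp add: below_def)

lemma below_child: "c \<in> set (ch u) \<Longrightarrow> u \<in> below v \<Longrightarrow> c \<in> below v"
  unfolding below_def by (auto intro: rtrancl_into_rtrancl simp: child_rel_def)

lemma below_trans: "u \<in> below v \<Longrightarrow> w \<in> below u \<Longrightarrow> w \<in> below v"
  unfolding below_def by (auto intro: rtrancl_trans)

lemma below_induct [consumes 1, case_names self child]:
  assumes "w \<in> below v" "P v" "\<And>u c. u \<in> below v \<Longrightarrow> P u \<Longrightarrow> c \<in> set (ch u) \<Longrightarrow> P c"
  shows "P w"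
proof -
  have "(v, w) \<in> (child_rel ch)\<^sup>*" using assms(1) by (simp add: below_def)
  then show ?thesis
    by (induction rule: rtrancl_induct) (auto intro: assms(2,3) simp: below_def child_rel_def)
qed

lemma below_unfold: "below v = insert v (\<Union>c\<in>set (ch v). below c)"
proof
  show "below v \<subseteq> insert v (\<Union>c\<in>set (ch v). below c)"
    unfolding below_def by (auto elim: converse_rtranclE simp: child_rel_def)
  show "insert v (\<Union>c\<in>set (ch v). below c) \<subseteq> below v"
    using below_trans[OF below_child[OF _ below_self]] by blast
qed

lemma dep_below: "w \<in> below v \<Longrightarrow> w = v \<or> dep v < dep w"
  by (induction rule: below_induct) (auto simp: dep_child)

text \<open>
  The ancestors of a vertex form a chain, because parents are unique, and \<open>dep\<close> is injective on
  this chain.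
\<close>

lemma below_disjoint:
  assumes "dep u = dep v" "u \<noteq> v"
  shows "below u \<inter> below v = {}"
proof -
  have "single_valued ((child_rel ch)\<inverse>)"
    by (auto simp: single_valued_def child_rel_def intro: parent_unique)
  then have "u \<in> below v \<or> v \<in> below u" if "w \<in> below u" "w \<in> below v" for w
    using single_valued_confluent[of _ w u v] that unfolding below_def mem_Collect_eq
    by (metis rtrancl_converseD rtrancl_converseI)
  then show ?thesis using dep_below assms by fastforce
qed

definition forest :: "'a list \<Rightarrow> 'a set" where
  "forest xs = (\<Union>x\<in>set xs. below x)"

abbreviation separated :: "'a list \<Rightarrow> bool" where
  "separated \<equiv> sorted_wrt (\<lambda>x y. below x \<inter> below y = {})"

lemma forest_simps [simp]:
  "forest [] = {}" "forest (x # xs) = below x \<union> forest xs" "forest (xs @ ys) = forest xs \<union> forest ys"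
  by (auto simp: forest_def)

lemma separated_append:
  "separated (xs @ ys) \<longleftrightarrow> separated xs \<and> separated ys \<and> forest xs \<inter> forest ys = {}"
  unfolding sorted_wrt_append forest_def by blast

lemma separated_Cons:
  "separated (x # xs) \<longleftrightarrow> separated xs \<and> below x \<inter> forest xs = {}"
  using separated_append[of "[x]" xs] by auto

lemma separated_ch: "separated (ch v)"
  unfolding sorted_wrt_iff_nth_less
proof (intro allI impI)
  fix i j assume "i < j" "j < length (ch v)"
  then have "ch v ! i \<noteq> ch v ! j" "ch v ! i \<in> set (ch v)" "ch v ! j \<in> set (ch v)"
    using distinct_ch nth_eq_iff_index_eq[of "ch v" i j] by auto
  then show "below (ch v ! i) \<inter> below (ch v ! j) = {}"
    using below_disjoint dep_child by metis
qed

lemma below_unfold_forest: "below v = insert v (forest (ch v))"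
  using below_unfold[of v] by (simp add: forest_def)

lemma notin_forest_ch: "v \<notin> forest (ch v)"
  using dep_below dep_child unfolding forest_def by fastforce

text \<open>
  The list holds the roots of a forest of pairwise disjoint trees. Replacing a root by its children
  removes exactly this vertex from the forest and leaves the trees disjoint.
\<close>

definition expand :: "'a list \<Rightarrow> 'a list" where
  "expand xs = ch (hd xs) @ tl xs"

lemma expand:
  assumes "xs \<noteq> []" "separated xs"
  shows "separated (expand xs)" "forest xs = insert (hd xs) (forest (expand xs))"
    "hd xs \<notin> forest (expand xs)"
proof -
  obtain x ys where xs: "xs = x # ys" using assms(1) by (cases xs) auto
  have "below x = insert x (forest (ch x))" "x \<notin> forest (ch x)"
    using below_unfold_forest notin_forest_ch by auto
  then show "separated (expand xs)" "forest xs = insert (hd xs) (forest (expand xs))"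
    "hd xs \<notin> forest (expand xs)"
    using assms(2) separated_ch by (auto simp: xs expand_def separated_append separated_Cons simp del: sorted_wrt.simps)
qed

lemma ch_nonempty:
  assumes "v \<in> below root"
  shows "ch v \<noteq> []"
proof
  assume "ch v = []"
  then have "below v = {v}" using below_unfold[of v] by simp
  moreover obtain x y where "x \<noteq> y" "x \<in> below v" "y \<in> below v"
    using ramified assms unfolding below_def by blast
  ultimately show False by auto
qed

definition frontier :: "nat \<Rightarrow> 'a \<Rightarrow> 'a list" where
  "frontier i v = (expand ^^ i) [v]"

lemma frontier_0 [simp]: "frontier 0 v = [v]"
  by (simp add: frontier_def)

lemma frontier_Suc: "frontier (Suc i) v = expand (frontier i v)"
  by (simp add: frontier_def)

lemma set_frontier: "set (frontier i v) \<subseteq> below v \<and> frontier i v \<noteq> []" if "v \<in> below root"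
proof (induction i)
  case (Suc i)
  then have "hd (frontier i v) \<in> below v" by (meson hd_in_set subsetD)
  moreover have "set (tl (frontier i v)) \<subseteq> below v"
    using Suc list.set_sel(2) by fastforce
  ultimately show ?case
    using below_child below_trans[OF that] ch_nonempty by (auto simp: frontier_Suc expand_def)
qed simp

text \<open>
  The heads of the successive lists are the vertices removed so far; together with the forest that
  remains they partition the descendants of the top vertex.
\<close>

lemma frontier_structure:
  assumes "v \<in> below root"
  shows "separated (frontier i v) \<and>
    below v = (\<lambda>j. hd (frontier j v)) ` {..<i} \<union> forest (frontier i v) \<and>
    (\<lambda>j. hd (frontier j v)) ` {..<i} \<inter> forest (frontier i v) = {} \<and>
    inj_on (\<lambda>j. hd (frontier j v)) {..<i}"
proof (induction i)
  case (Suc i)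
  have ne: "frontier i v \<noteq> []" using set_frontier[OF assms] by blast
  note e = expand[OF ne, folded frontier_Suc]
  have "hd (frontier i v) \<notin> (\<lambda>j. hd (frontier j v)) ` {..<i}"
    using Suc e by auto
  then show ?case using Suc e by (auto simp: lessThan_Suc)
qed simp

lemma length_frontier_mono:
  assumes "v \<in> below root" "i \<le> j"
  shows "length (frontier i v) \<le> length (frontier j v)"
  using assms(2)
proof (induction rule: dec_induct)
  case (step j)
  have f: "set (frontier j v) \<subseteq> below v" "frontier j v \<noteq> []"
    using set_frontier[OF assms(1)] by auto
  then have "ch (hd (frontier j v)) \<noteq> []"
    using ch_nonempty below_trans[OF assms(1)] hd_in_set by blast
  then have "length (frontier j v) \<le> length (frontier (Suc j) v)"
    by (cases "frontier j v"; cases "ch (hd (frontier j v))") (use f(2) in \<open>auto simp: frontier_Suc expand_def\<close>)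
  then show ?case using step by simp
qed simp

lemma length_frontier_le: "length (frontier i v) \<le> 1 + i * m"
proof (induction i)
  case (Suc i)
  have "length (frontier (Suc i) v) \<le> m + length (frontier i v)"
    using length_ch[of "hd (frontier i v)"] by (simp add: frontier_Suc expand_def)
  then show ?case using Suc by simp
qed simp

text \<open>
  The frontier never shrinks, so if it had a single element after \<open>L \<ge> n\<close> steps then it had a
  single element all along; the first \<open>n\<close> generations below \<open>v\<close> would be a path, leaving
  only one descendant at depth \<open>n\<close>.
\<close>

lemma length_frontier_ge_2:
  assumes "v \<in> below root" "n \<le> L"
  shows "2 \<le> length (frontier L v)"
proof (rule ccontr)
  assume "\<not> 2 \<le> length (frontier L v)"
  then have length_1: "length (frontier i v) = 1" if "i \<le> n" for i
    using length_frontier_mono[OF assms(1), of i L] set_frontier[OF assms(1), of i] that assms(2)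
    by (cases "frontier i v") (auto simp: not_le less_2_cases_iff)
  then have single: "frontier i v = [hd (frontier i v)]" if "i \<le> n" for i
    using length_1[OF that] by (cases "frontier i v") auto
  have dep: "dep (hd (frontier i v)) = dep v + i" if "i \<le> n" for i
    using that
  proof (induction i)
    case (Suc i)
    have "frontier (Suc i) v = ch (hd (frontier i v))"
      using single[of i] Suc.prems by (simp add: frontier_Suc expand_def) (metis append_Nil2 list.sel(3))
    then have "hd (frontier (Suc i) v) \<in> set (ch (hd (frontier i v)))"
      using set_frontier[OF assms(1), of "Suc i"] by simp
    then show ?case using dep_child Suc by fastforce
  qed simp
  have "x = hd (frontier n v)" if "x \<in> below v" "dep x = dep v + n" for x
  proof -
    have "x \<notin> (\<lambda>j. hd (frontier j v)) ` {..<n}" using dep that(2) by auto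
    then have "x \<in> forest (frontier n v)"
      using frontier_structure[OF assms(1), of n] that(1) by auto
    then have "x \<in> below (hd (frontier n v))" using single[of n]
      by (metis Un_iff empty_iff forest_simps(1,2) order_refl)
    then show ?thesis using dep_below dep that(2) by fastforce
  qed
  moreover obtain x y where "x \<noteq> y" "x \<in> below v" "y \<in> below v" "dep x = dep v + n" "dep y = dep v + n"
    using ramified assms(1) unfolding below_def by blast
  ultimately show False by metis
qed

context
  fixes L :: nat
  assumes n_le_L: "n \<le> L" and L_pos: "0 < L"
begin

text \<open>
  The block tops waiting at a word: the one that the word owns, followed by siblings of it
  for which an owner is still to be found among the words below. The empty list never occurs.
\<close>

fun queue :: "bool list \<Rightarrow> 'a list" where
  "queue [] = [root]"
| "queue (b # w) =
    (case queue w of [] \<Rightarrow> [] | v # vs \<Rightarrow>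
      if vs = [] then (if b then tl (frontier L v) else [hd (frontier L v)])
      else (if b then vs else frontier L v))"

text \<open>
  A queue is a part of the frontier of a single block, which bounds its diameter. Adding \<open>u\<close> to
  the frontier covers the queue of the empty word, which consists of the root.
\<close>

lemma queue_invariant:
  "queue w \<noteq> [] \<and> separated (queue w) \<and>
    (\<exists>u\<in>below root. set (queue w) \<subseteq> set (frontier L u) \<union> {u})"
proof (induction w)
  case Nil
  then show ?case by auto
next
  case (Cons b w)
  then obtain v vs where q: "queue w = v # vs" by (cases "queue w") auto
  obtain u where u: "u \<in> below root" "set (queue w) \<subseteq> set (frontier L u) \<union> {u}"
    using Cons by blast
  then have v: "v \<in> below root"
    using set_frontier[OF u(1), of L] below_trans[OF u(1)] u(1) q by auto
  obtain x y ys where f: "frontier L v = x # y # ys"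
    using length_frontier_ge_2[OF v n_le_L] by (metis Suc_le_length_iff numeral_2_eq_2)
  have "separated (frontier L v)" using frontier_structure[OF v] by blast
  then have i: "separated (queue (b # w))" and ne: "queue (b # w) \<noteq> []"
    using Cons.IH q f by (auto simp: separated_Cons simp del: sorted_wrt.simps(2))
  consider "set (queue (b # w)) \<subseteq> set (frontier L v)" | "set (queue (b # w)) \<subseteq> set (queue w)"
    using q f by (cases "vs = []"; cases b) auto
  then show ?case using i ne u v by cases blast+
qed

lemma queue_in_tree: "set (queue w) \<subseteq> below root"
  using queue_invariant[of w] set_frontier below_trans by (blast dest: subsetD)

definition leader :: "bool list \<Rightarrow> 'a" where
  "leader w = hd (queue w)"

lemma leader_in_tree: "leader w \<in> below root"
  using queue_in_tree queue_invariant unfolding leader_def by (meson hd_in_set subsetD)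

text \<open>
  The head of \<open>frontier i v\<close> is the vertex removed in step \<open>i\<close>, so for \<open>i < L\<close> these heads
  enumerate the block with top \<open>v\<close>.
\<close>

definition place :: "bool list \<times> nat \<Rightarrow> 'a" where
  "place = (\<lambda>(w, i). hd (frontier i (leader w)))"

lemma leader_eq_place: "leader w = place (w, 0)"
  by (simp add: place_def)

text \<open>
  The vertices at or below a word are distributed without overlap to the word itself and its two
  extensions. Injectivity of the coordinates follows from this alone.
\<close>

lemma queue_split:
  "forest (queue w) =
    (\<lambda>i. place (w, i)) ` {..<L} \<union> forest (queue (False # w)) \<union> forest (queue (True # w))"
  "(\<lambda>i. place (w, i)) ` {..<L} \<inter> forest (queue (b # w)) = {}"
  "forest (queue (False # w)) \<inter> forest (queue (True # w)) = {}"
proof -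
  obtain v vs where q: "queue w = v # vs" using queue_invariant by (cases "queue w") auto
  then have v: "v = leader w" by (simp add: leader_def)
  have ind: "below v \<inter> forest vs = {}"
    using queue_invariant[of w] q by (simp add: separated_Cons del: sorted_wrt.simps)
  note s = frontier_structure[OF leader_in_tree, of L w, folded v]
  have place: "(\<lambda>i. place (w, i)) = (\<lambda>i. hd (frontier i v))" by (simp add: place_def v)
  obtain x ys where f: "frontier L v = x # ys"
    using set_frontier[OF leader_in_tree, of L w, folded v] by (cases "frontier L v") auto
  have "below x \<inter> forest ys = {}"
    using s f by (simp add: separated_Cons del: sorted_wrt.simps)
  then show "forest (queue w) =
    (\<lambda>i. place (w, i)) ` {..<L} \<union> forest (queue (False # w)) \<union> forest (queue (True # w))"
  "(\<lambda>i. place (w, i)) ` {..<L} \<inter> forest (queue (b # w)) = {}"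
  "forest (queue (False # w)) \<inter> forest (queue (True # w)) = {}"
    using s f q ind unfolding place by (auto simp del: sorted_wrt.simps)
qed

lemma forest_queue_append: "forest (queue (u @ w)) \<subseteq> forest (queue w)"
proof (induction u)
  case (Cons b u)
  have "forest (queue (b # u @ w)) \<subseteq> forest (queue (u @ w))"
    using queue_split(1)[of "u @ w"] by (cases b) auto
  then show ?case using Cons by simp
qed simp

lemma place_in_forest: "i < L \<Longrightarrow> place (w, i) \<in> forest (queue w)"
  using queue_split(1) by blast

lemma forest_queue_disjoint:
  "length x = length y \<Longrightarrow> x \<noteq> y \<Longrightarrow> forest (queue x) \<inter> forest (queue y) = {}"
proof (induction x y rule: list_induct2)
  case (Cons b x c y)
  show ?case
  proof (cases "x = y")
    case True
    then show ?thesis using Cons.prems queue_split(3)[of y] by (cases b; cases c) auto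
  next
    case False
    then show ?thesis
      using Cons.IH forest_queue_append[of "[b]" x] forest_queue_append[of "[c]" y] by auto
  qed
qed simp

text \<open>
  Of two different words, cut the longer one to the length of the shorter. Either the results
  differ, and their forests are disjoint, or the longer word extends the shorter one, and its
  vertices lie in the forest left over when the block of the shorter word is removed.
\<close>

lemma place_inj: "inj_on place (UNIV \<times> {..<L})"
proof -
  have ne: "place (x, i) \<noteq> place (y, j)"
    if "x \<noteq> y" "length x \<le> length y" "i < L" "j < L" for x y i j
  proof -
    define u z where "u = take (length y - length x) y" and "z = drop (length y - length x) y"
    then have y: "y = u @ z" and len: "length x = length z" using that(2) by auto
    have j: "place (y, j) \<in> forest (queue (u @ z))" using place_in_forest[OF that(4)] y by simp
    show ?thesis
    proof (cases "x = z")
      case True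
      then have "u \<noteq> []" using y that(1) by auto
      then obtain u' b where "u = u' @ [b]" by (metis rev_exhaust)
      then have "place (y, j) \<in> forest (queue (b # x))"
        using j forest_queue_append[of u' "b # z"] True by auto
      then show ?thesis using queue_split(2)[of x b] that(3) by (metis IntI emptyE image_eqI lessThan_iff)
    next
      case False
      then show ?thesis
        using forest_queue_disjoint[OF len] j forest_queue_append[of u z] place_in_forest[OF that(3)]
        by (metis IntI emptyE subsetD)
    qed
  qed
  show ?thesis
  proof (rule inj_onI, clarify)
    fix x i y j assume eq: "place (x, i) = place (y, j)" and ij: "i < L" "j < L"
    then have "x = y" using ne[of x y i j] ne[of y x j i] by (metis linear)
    moreover have "inj_on (\<lambda>j. hd (frontier j (leader x))) {..<L}"
      using frontier_structure[OF leader_in_tree] by blast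
    ultimately show "x = y \<and> i = j" using eq ij by (auto simp: place_def inj_on_def)
  qed
qed

lemma place_in_tree: "place (w, i) \<in> below root"
  using set_frontier[OF leader_in_tree[of w], of i] below_trans[OF leader_in_tree[of w]]
  by (auto simp: place_def subset_iff)

text \<open>Each letter \<open>True\<close> drops one element of the queue.\<close>

lemma leader_queue_nth:
  "j < length (queue w) \<Longrightarrow> \<exists>w'. leader w' = queue w ! j \<and> (w, w') \<in> word_rel ^^ j"
proof (induction j arbitrary: w)
  case 0
  then show ?case by (intro exI[of _ w]) (auto simp: leader_def hd_conv_nth)
next
  case (Suc j)
  then obtain v vs where q: "queue w = v # vs" by (cases "queue w") auto
  then have t: "queue (True # w) = vs" using Suc.prems by auto
  then obtain w' where "leader w' = queue w ! Suc j" "(True # w, w') \<in> word_rel ^^ j"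
    using Suc.IH[of "True # w"] Suc.prems q by auto
  moreover have "(w, True # w) \<in> word_rel" unfolding word_rel_def by blast
  ultimately show ?case using relpow_Suc_I2 by metis
qed

lemma leader_frontier:
  assumes "v \<in> set (frontier L (leader w))"
  shows "\<exists>w'. leader w' = v \<and> (w, w') \<in> word_rel ^^ (1 + L * m)"
proof -
  let ?D = "frontier L (leader w)"
  obtain vs where q: "queue w = leader w # vs"
    using queue_invariant[of w] unfolding leader_def by (cases "queue w") auto
  have step: "(w, b # w) \<in> word_rel" for b by (simp add: word_rel_def)
  obtain k where k: "k < length ?D" "?D ! k = v" using assms by (auto simp: in_set_conv_nth)
  have len: "length ?D \<le> 1 + L * m" by (rule length_frontier_le)
  have "\<exists>w'. leader w' = v \<and> (w, w') \<in> word_rel ^^ Suc k"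
  proof (cases "vs = []")
    case False
    then have "queue (False # w) = ?D" using q by simp
    then show ?thesis
      using leader_queue_nth[of k "False # w"] k step relpow_Suc_I2 by metis
  next
    case True
    then have fq: "queue (False # w) = [hd ?D]" and tq: "queue (True # w) = tl ?D" using q by simp_all
    show ?thesis
    proof (cases k)
      case 0
      then have "leader (False # w) = v" using fq k by (auto simp: leader_def hd_conv_nth)
      then show ?thesis using 0 step by (auto intro!: exI[of _ "False # w"])
    next
      case (Suc k')
      then have "k' < length (queue (True # w))" "queue (True # w) ! k' = v"
        using k tq by (auto simp: nth_tl)
      then obtain w' where "leader w' = v" "(True # w, w') \<in> word_rel ^^ k'"
        using leader_queue_nth by metis
      then have "(w, w') \<in> word_rel ^^ Suc k'" using step relpow_Suc_I2 by metis
      then have "(w, w') \<in> word_rel ^^ Suc k" using Suc word_rel_mono[of "Suc k'" "Suc k"] by simp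
      then show ?thesis using \<open>leader w' = v\<close> by blast
    qed
  qed
  moreover have "Suc k \<le> 1 + L * m" using k(1) len by simp
  ultimately show ?thesis using word_rel_mono by blast
qed

lemma frontier_later:
  assumes "v \<in> set (frontier i u)" "i \<le> l"
  shows "v \<in> set (frontier l u) \<or> (\<exists>j<l. v = hd (frontier j u))"
  using assms(2)
proof (induction rule: dec_induct)
  case (step l)
  then consider "v \<in> set (frontier l u)" | j where "j < l" "v = hd (frontier j u)" by blast
  then show ?case
  proof cases
    case 1
    then have "v = hd (frontier l u) \<or> v \<in> set (tl (frontier l u))"
      by (cases "frontier l u") auto
    then show ?thesis by (auto simp: frontier_Suc expand_def)
  qed (use less_Suc_eq in blast)
qed (use assms in simp)

text \<open>
  A child of a vertex enters the waiting list when that vertex is removed. It is then either removed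
  later on, hence in the same block, or reaches the frontier, whose tops are owned by words at
  most as many letters away as the frontier is long.
\<close>

lemma place_child:
  assumes "i < L" "v \<in> set (ch (place (w, i)))"
  shows "\<exists>w' j. j < L \<and> place (w', j) = v \<and> (w, w') \<in> word_rel ^^ (1 + L * m)"
proof -
  have "v \<in> set (frontier (Suc i) (leader w))"
    using assms(2) by (simp add: frontier_Suc expand_def place_def)
  then consider "v \<in> set (frontier L (leader w))" | j where "j < L" "v = place (w, j)"
    using frontier_later[of v "Suc i" "leader w" L] assms(1) by (auto simp: place_def)
  then show ?thesis
  proof cases
    case 1
    then show ?thesis using leader_frontier L_pos leader_eq_place by metis
  next
    case 2
    then show ?thesis using word_rel_mono[of 0 "1 + L * m" w w] by auto
  qed
qed

lemma bij_betw_place: "bij_betw place (UNIV \<times> {..<L}) (below root)"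
  unfolding bij_betw_def
proof (intro conjI place_inj subset_antisym subsetI)
  fix v assume "v \<in> below root"
  then show "v \<in> place ` (UNIV \<times> {..<L})"
  proof (induction rule: below_induct)
    case self
    have "leader [] = root" by (simp add: leader_def)
    then show ?case using L_pos leader_eq_place by (metis SigmaI UNIV_I image_eqI lessThan_iff)
  next
    case (child u c)
    then obtain w i where wi: "i < L" "u = place (w, i)" by auto
    then obtain w' j where "j < L" "place (w', j) = c"
      using place_child[OF wi(1) child.hyps(2)[unfolded wi(2)]] by blast
    then have "c = place (w', j)" "(w', j) \<in> UNIV \<times> {..<L}" by simp_all
    then show ?case by (rule image_eqI)
  qed
qed (use place_in_tree in auto)

context
  fixes d :: "'a \<Rightarrow> 'a \<Rightarrow> real"
  assumes metric: "Metric_space (below root) d"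
    and d_child: "u \<in> below root \<Longrightarrow> v \<in> set (ch u) \<Longrightarrow> d u v \<le> 1"
begin

interpretation Metric_space "below root" d by (rule metric)

lemma d_frontier:
  assumes "v \<in> below root"
  shows "x \<in> set (frontier i v) \<Longrightarrow> d v x \<le> real i"
proof (induction i arbitrary: x)
  case 0
  then show ?case using assms by simp
next
  case (Suc i)
  let ?h = "hd (frontier i v)"
  have f: "set (frontier i v) \<subseteq> below v" "frontier i v \<noteq> []" using set_frontier[OF assms] by auto
  consider "x \<in> set (ch ?h)" | "x \<in> set (frontier i v)"
    using Suc.prems list.set_sel(2)[OF f(2)] by (auto simp: frontier_Suc expand_def)
  then show ?case
  proof cases
    case 1
    have h: "?h \<in> below root" using f below_trans[OF assms] hd_in_set by blast
    then have "x \<in> below root" using 1 below_child by blast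
    then have "d v x \<le> d v ?h + d ?h x" using triangle assms h by blast
    moreover have "d v ?h \<le> i" using Suc.IH f(2) by simp
    ultimately show ?thesis using d_child[OF h 1] by simp
  next
    case 2
    then show ?thesis using Suc.IH by fastforce
  qed
qed

lemma d_queue:
  assumes "x \<in> set (queue w)" "y \<in> set (queue w)"
  shows "d x y \<le> 2 * real L"
proof -
  obtain u where u: "u \<in> below root" "set (queue w) \<subseteq> set (frontier L u) \<union> {u}"
    using queue_invariant by blast
  then have near: "d u z \<le> real L" if "z \<in> set (queue w)" for z
    using that d_frontier[OF u(1)] by fastforce
  have "x \<in> below root" "y \<in> below root" using assms queue_in_tree by auto
  then have "d x y \<le> d u x + d u y" using triangle[of x u y] u(1) commute by metis
  then show ?thesis using near[OF assms(1)] near[OF assms(2)] by simp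
qed

lemma d_leader_Cons: "d (leader w) (leader (b # w)) \<le> 2 * real L"
proof -
  obtain vs where q: "queue w = leader w # vs"
    using queue_invariant[of w] unfolding leader_def by (cases "queue w") auto
  have "set (queue (b # w)) \<subseteq> set (frontier L (leader w)) \<union> set (queue w)"
    using set_frontier[OF leader_in_tree[of w], of L]
    by (cases "frontier L (leader w)"; cases "vs = []"; cases b) (auto simp: q)
  moreover have "leader (b # w) \<in> set (queue (b # w))"
    using queue_invariant[of "b # w"] unfolding leader_def by (simp del: queue.simps)
  ultimately have "leader (b # w) \<in> set (frontier L (leader w)) \<or> leader (b # w) \<in> set (queue w)"
    by blast
  then show ?thesis
  proof
    assume "leader (b # w) \<in> set (frontier L (leader w))"
    then show ?thesis using d_frontier[OF leader_in_tree] by fastforce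
  next
    assume "leader (b # w) \<in> set (queue w)"
    moreover have "leader w \<in> set (queue w)" using q by simp
    ultimately show ?thesis by (rule d_queue[rotated])
  qed
qed

lemma d_place_word_rel:
  assumes "(w, w') \<in> word_rel" "i < L" "j < L"
  shows "d (place (w, i)) (place (w', j)) \<le> 4 * real L"
proof -
  have near: "d (leader w) (place (w, i)) \<le> real L" if "i < L" for w i
  proof -
    have "place (w, i) \<in> set (frontier i (leader w))"
      using set_frontier[OF leader_in_tree[of w], of i] by (simp add: place_def)
    then have "d (leader w) (place (w, i)) \<le> real i" by (rule d_frontier[OF leader_in_tree])
    then show ?thesis using that by simp
  qed
  have "d (leader w) (leader w') \<le> 2 * real L"
    using assms(1) d_leader_Cons commute leader_in_tree by (auto simp: word_rel_def)
  moreover have "d (place (w, i)) (place (w', j)) \<le>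
      d (leader w) (place (w, i)) + d (leader w) (leader w') + d (leader w') (place (w', j))"
    using triangle[of "place (w, i)" "leader w" "place (w', j)"]
      triangle[of "leader w" "leader w'" "place (w', j)"] place_in_tree leader_in_tree
      commute[of "leader w" "place (w, i)"] by simp
  ultimately show ?thesis using near[OF assms(2), of w] near[OF assms(3), of w'] by simp
qed

text \<open>
  The intermediate words are represented by their slot \<open>0\<close>; the summand \<open>1\<close> in \<open>Suc k\<close> pays
  for changing the slot when \<open>k = 0\<close>.
\<close>

lemma d_place_relpow:
  assumes "(w, w') \<in> word_rel ^^ k" "i < L" "j < L"
  shows "d (place (w, i)) (place (w', j)) \<le> real (Suc k) * (4 * real L)"
  using assms(1,3)
proof (induction k arbitrary: w' j)
  case 0
  then show ?case using d_place_word_rel[OF word_rel_refl assms(2)] by auto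
next
  case (Suc k)
  then obtain x where x: "(w, x) \<in> word_rel ^^ k" "(x, w') \<in> word_rel" by auto
  have "d (place (w, i)) (place (w', j)) \<le> d (place (w, i)) (place (x, 0)) + d (place (x, 0)) (place (w', j))"
    using triangle place_in_tree by blast
  also have "\<dots> \<le> real (Suc k) * (4 * real L) + 4 * real L"
    by (intro add_mono Suc.IH[OF x(1) L_pos] d_place_word_rel[OF x(2) L_pos Suc.prems(2)])
  finally show ?case by (simp add: algebra_simps)
qed

end

end

end

section \<open>Levels and parents in a rooted tree\<close>

definition adjacent :: "'a set set \<Rightarrow> 'a rel" where
  "adjacent F = {(u, w). {u, w} \<in> F}"

lemma sym_adjacent: "sym (adjacent F)"
  by (auto simp: sym_def adjacent_def insert_commute)

lemma distinct_walk_of_adjacent: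
  assumes "(a, x) \<in> (adjacent F)\<^sup>*" "a \<in> V" "\<Union> F \<subseteq> V"
  shows "\<exists>p. walk V F p \<and> distinct p \<and> hd p = a \<and> last p = x"
  using assms(1)
proof (induction rule: rtrancl_induct)
  case base
  then show ?case using assms(2) by (intro exI[of _ "[a]"]) (auto simp: walk_def)
next
  case (step x y)
  then obtain p where p: "walk V F p" "distinct p" "hd p = a" "last p = x" by blast
  have xy: "{x, y} \<in> F" using step(2) by (simp add: adjacent_def)
  show ?case
  proof (cases "y \<in> set p")
    case True
    then obtain xs ys where "p = xs @ y # ys" by (meson split_list)
    then show ?thesis
      using p by (intro exI[of _ "xs @ [y]"]) (auto simp: walk_def successively_append_iff hd_append)
  next
    case False
    then show ?thesis
      using p xy assms(3)
      by (intro exI[of _ "p @ [y]"]) (auto simp: walk_def successively_append_iff)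
  qed
qed

locale tree_with_root =
  fixes V :: "'a set" and E :: "'a set set" and r :: 'a
  assumes rooted: "rooted_tree V E r"
begin

lemma simple: "simple_graph V E" and connected: "connected_graph V E" and r_in_V: "r \<in> V"
  using rooted by (auto simp: rooted_tree_def tree_def)

lemma edge: "{u, w} \<in> E \<Longrightarrow> u \<noteq> w \<and> u \<in> V \<and> w \<in> V"
  using simple by (auto simp: simple_graph_def)

text \<open>
  A detour around the edge would close up to a cycle. This is how acyclicity is used.
\<close>

lemma edge_is_bridge:
  assumes "{a, b} \<in> E"
  shows "(a, b) \<notin> (adjacent (E - {{a, b}}))\<^sup>*"
proof
  assume ab: "(a, b) \<in> (adjacent (E - {{a, b}}))\<^sup>*"
  have "\<Union> (E - {{a, b}}) \<subseteq> V" using simple by (auto simp: simple_graph_def)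
  then obtain p where p: "walk V (E - {{a, b}}) p" "distinct p" "hd p = a" "last p = b"
    using distinct_walk_of_adjacent[OF ab] edge[OF assms] by blast
  have "walk V E p"
    using p(1) unfolding walk_def by (auto elim: successively_mono)
  moreover have "3 \<le> length p"
  proof (rule ccontr)
    assume "\<not> 3 \<le> length p"
    then have "length p = 0 \<or> length p = Suc 0 \<or> length p = Suc (Suc 0)" by linarith
    then have "p = [a] \<or> p = [a, b]"
      using p(1,3,4) by (auto simp: walk_def length_Suc_conv)
    moreover have "p \<noteq> [a]" using p(4) edge[OF assms] by auto
    moreover have "p \<noteq> [a, b]" using p(1) by (auto simp: walk_def)
    ultimately show False by blast
  qed
  ultimately have "graph_cycle V E p"
    using p assms by (simp add: graph_cycle_def insert_commute)
  then show False using rooted by (auto simp: rooted_tree_def tree_def)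
qed

definition level :: "'a \<Rightarrow> nat" where
  "level u = (LEAST n. \<exists>p. walk V E p \<and> hd p = u \<and> last p = r \<and> length p = Suc n)"

lemma shortest_walk:
  assumes "u \<in> V"
  obtains p where "walk V E p" "hd p = u" "last p = r" "length p = Suc (level u)"
proof -
  obtain p where p: "walk V E p" "hd p = u" "last p = r"
    using connected assms r_in_V unfolding connected_graph_def by blast
  then have "\<exists>p'. walk V E p' \<and> hd p' = u \<and> last p' = r \<and> length p' = Suc (length p - 1)"
    by (intro exI[of _ p]) (auto simp: walk_def)
  then have "\<exists>p'. walk V E p' \<and> hd p' = u \<and> last p' = r \<and> length p' = Suc (level u)"
    unfolding level_def by (rule LeastI)
  then show ?thesis using that by blast
qed

lemma level_le: "walk V E p \<Longrightarrow> last p = r \<Longrightarrow> length p = Suc n \<Longrightarrow> level (hd p) \<le> n"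
  unfolding level_def by (rule Least_le) blast

lemma level_root [simp]: "level r = 0"
  using level_le[of "[r]" 0] r_in_V by (simp add: walk_def)

lemma level_edge:
  assumes "{u, w} \<in> E"
  shows "level u \<le> Suc (level w)"
proof -
  obtain p where p: "walk V E p" "hd p = w" "last p = r" "length p = Suc (level w)"
    using shortest_walk edge[OF assms] by metis
  then have "walk V E (u # p)"
    using assms edge[OF assms] by (simp add: walk_def successively_Cons)
  then show ?thesis using level_le[of "u # p" "Suc (level w)"] p by (simp add: walk_def)
qed

lemma parent_exists:
  assumes "u \<in> V" "u \<noteq> r"
  obtains w where "{u, w} \<in> E" "level u = Suc (level w)"
proof -
  obtain p where p: "walk V E p" "hd p = u" "last p = r" "length p = Suc (level u)"
    using shortest_walk[OF assms(1)] .
  then obtain q where q: "p = u # q" by (cases p) auto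
  then obtain w q' where "q = w # q'" using p assms(2) by (cases q) auto
  then have w: "{u, w} \<in> E" "walk V E q" "last q = r" "length q = level u" "hd q = w"
    using p q by (auto simp: walk_def)
  then have "Suc (level w) \<le> level u"
    using level_le[of q "level u - 1"] \<open>q = w # q'\<close> by auto
  then have "level u = Suc (level w)" using level_edge[OF w(1)] by simp
  then show ?thesis using that w(1) by blast
qed

text \<open>
  The path follows parents, so each of its edges leads upwards from \<open>u\<close> itself or from a vertex of
  smaller level. Only such edges are required to be in \<open>F\<close>, so that the path can be seen to avoid
  a given edge.
\<close>

lemma ascend_to_root:
  assumes "u \<in> V"
    and "\<And>x y. {x, y} \<in> E \<Longrightarrow> level y < level x \<Longrightarrow> x = u \<or> level x < level u \<Longrightarrow> {x, y} \<in> F"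
  shows "(u, r) \<in> (adjacent F)\<^sup>*"
  using assms
proof (induction "level u" arbitrary: u rule: less_induct)
  case less
  show ?case
  proof (cases "u = r")
    case False
    then obtain w where w: "{u, w} \<in> E" "level u = Suc (level w)"
      using parent_exists less.prems(1) by metis
    then have "(w, r) \<in> (adjacent F)\<^sup>*"
      using less.prems(2) edge[OF w(1)] by (intro less.hyps) auto
    moreover have "(u, w) \<in> adjacent F" using less.prems(2) w by (simp add: adjacent_def)
    ultimately show ?thesis by (rule converse_rtrancl_into_rtrancl[rotated])
  qed simp
qed

text \<open>
  Otherwise the way from \<open>b\<close> up to the root and down again through \<open>a\<close> leads to \<open>v\<close> without
  the edge joining \<open>b\<close> and \<open>v\<close>, which would then not be a bridge.
\<close>

lemma neighbour_not_deeper_is_parent: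
  assumes "{v, a} \<in> E" "level v = Suc (level a)" "{v, b} \<in> E" "level b \<le> level v"
  shows "a = b"
proof (rule ccontr)
  assume "a \<noteq> b"
  let ?F = "E - {{b, v}}"
  have vb: "{b, v} \<in> E" "v \<noteq> b" using assms(3) edge by (auto simp: insert_commute)
  have "(b, r) \<in> (adjacent ?F)\<^sup>*"
  proof (rule ascend_to_root)
    fix x y assume "{x, y} \<in> E" "level y < level x" "x = b \<or> level x < level b"
    then show "{x, y} \<in> ?F" using assms(4) vb(2) by (auto simp: doubleton_eq_iff)
  qed (use edge[OF vb(1)] in blast)
  moreover have "(a, r) \<in> (adjacent ?F)\<^sup>*"
  proof (rule ascend_to_root)
    fix x y assume "{x, y} \<in> E" "level y < level x" "x = a \<or> level x < level a"
    then show "{x, y} \<in> ?F" using assms(2,4) vb(2) by (auto simp: doubleton_eq_iff)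
  qed (use edge[OF assms(1)] in blast)
  then have "(r, a) \<in> (adjacent ?F)\<^sup>*" by (rule symD[OF sym_rtrancl[OF sym_adjacent]])
  moreover have "(a, v) \<in> adjacent ?F"
    using assms(1) \<open>a \<noteq> b\<close> vb(2) edge[OF assms(1)] by (auto simp: adjacent_def insert_commute doubleton_eq_iff)
  ultimately have "(b, v) \<in> (adjacent ?F)\<^sup>*"
    by (blast intro: rtrancl_trans rtrancl_into_rtrancl)
  then show False using edge_is_bridge[OF vb(1)] by blast
qed

lemma level_0_iff: "u \<in> V \<Longrightarrow> level u = 0 \<longleftrightarrow> u = r"
  using parent_exists by (metis level_root nat.distinct(1))

lemma edge_levels:
  assumes "{u, w} \<in> E"
  shows "level w = Suc (level u) \<or> level u = Suc (level w)"
proof (rule ccontr)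
  assume neg: "\<not> ?thesis"
  have wu: "{w, u} \<in> E" using assms by (simp add: insert_commute)
  have eq: "level u = level w" using neg level_edge[OF assms] level_edge[OF wu] by linarith
  have "u \<noteq> r" using level_0_iff[of u] level_0_iff[of w] edge[OF assms] eq by auto
  then obtain a where a: "{u, a} \<in> E" "level u = Suc (level a)"
    using parent_exists[of u] edge[OF assms] by blast
  then have "a = w" using neighbour_not_deeper_is_parent[OF a assms] eq by simp
  then show False using a(2) eq by simp
qed

definition parent_of :: "'a \<Rightarrow> 'a \<Rightarrow> bool" where
  "parent_of u w \<longleftrightarrow> {u, w} \<in> E \<and> level w = Suc (level u)"

lemma parent_of_unique: "parent_of u w \<Longrightarrow> parent_of u' w \<Longrightarrow> u = u'"
  using neighbour_not_deeper_is_parent[of w u u'] by (simp add: parent_of_def insert_commute)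

lemma edge_cases:
  assumes "e \<in> E"
  obtains p q where "e = {p, q}" "parent_of p q"
proof -
  obtain u w where e: "e = {u, w}" using simple_graphE[OF simple assms] by metis
  have "{u, w} \<in> E" "{w, u} \<in> E" "e = {w, u}" using assms e by (simp_all add: insert_commute)
  then have "parent_of u w \<or> parent_of w u" using edge_levels by (simp add: parent_of_def)
  then show ?thesis using that e \<open>e = {w, u}\<close> by blast
qed

abbreviation d :: "('a \<Rightarrow> real) \<Rightarrow> ('a \<Rightarrow> real) \<Rightarrow> real" where
  "d \<equiv> path_dist E"

interpretation Metric_space "graph_points V E" d
  by (rule Metric_space_path_dist[OF simple connected])

lemma vertex_in_points: "v \<in> V \<Longrightarrow> vertex_point v \<in> graph_points V E"
  by (simp add: graph_points_def)

lemma dist_root_vertex: "v \<in> V \<Longrightarrow> d (vertex_point r) (vertex_point v) = real (level v)"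
  using path_dist_vertex_point[OF simple connected, of v r] r_in_V commute
  by (simp add: level_def)

text \<open>
  The extension of a function on the vertices that is affine on every edge. It transfers lower
  bounds for distances from vertices to all points of the graph.
\<close>

definition extend :: "('a \<Rightarrow> real) \<Rightarrow> ('a \<Rightarrow> real) \<Rightarrow> real" where
  "extend f x = (\<Sum>u | x u \<noteq> 0. x u * f u)"

lemma extend_edge:
  assumes "a \<noteq> b" "x \<in> edge_points {a, b}"
  shows "extend f x = x a * f a + x b * f b"
proof -
  have "extend f x = (\<Sum>u\<in>{a, b}. x u * f u)"
    unfolding extend_def using assms by (intro sum.mono_neutral_left) (auto simp: edge_points_pair)
  then show ?thesis using assms(1) by simp
qed

lemma extend_vertex [simp]: "extend f (vertex_point u) = f u"
proof -
  have "{w. vertex_point u w \<noteq> 0} = {u}" by (auto simp: vertex_point_def indicator_def)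
  then show ?thesis by (simp add: extend_def vertex_point_def)
qed

lemma extend_lipschitz:
  assumes "\<And>p q. parent_of p q \<Longrightarrow> \<bar>f p - f q\<bar> \<le> 1"
    and "x \<in> graph_points V E" "y \<in> graph_points V E"
  shows "\<bar>extend f x - extend f y\<bar> \<le> d x y"
proof -
  have lip: "\<bar>extend f x - extend f y\<bar> \<le> edge_dist e x y"
    if e: "e \<in> E" "x \<in> edge_points e" "y \<in> edge_points e" for e x y
  proof -
    obtain p q where pq: "e = {p, q}" "parent_of p q" using edge_cases[OF e(1)] .
    then have ne: "p \<noteq> q" using edge by (auto simp: parent_of_def)
    have xy: "x \<in> edge_points {p, q}" "y \<in> edge_points {p, q}" using e pq by simp_all
    then have q: "x q = 1 - x p" "y q = 1 - y p" by (simp_all add: edge_points_pair[OF ne])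
    have "extend f x - extend f y = (x p - y p) * (f p - f q)"
      unfolding extend_edge[OF ne xy(1)] extend_edge[OF ne xy(2)] q by (simp add: algebra_simps)
    then have "\<bar>extend f x - extend f y\<bar> \<le> \<bar>x p - y p\<bar>"
      using assms(1)[OF pq(2)] by (simp add: abs_mult mult_left_le)
    then show ?thesis using edge_dist_pair(1)[OF ne xy] pq(1) by simp
  qed
  have "\<bar>extend f x - extend f y\<bar> \<le> l" if "path_length E x y l" for l
    using that lip by (rule path_length_lipschitz)
  moreover obtain l where "path_length E x y l"
    using path_length_exists[OF simple connected assms(2,3)] ..
  ultimately show ?thesis by (intro path_dist_lower)
qed

lemma dist_root_edge_point:
  assumes "parent_of p q" "y \<in> edge_points {p, q}"
  shows "d (vertex_point r) y = real (level p) + y q"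
proof -
  have e: "{p, q} \<in> E" "level q = Suc (level p)" using assms(1) by (auto simp: parent_of_def)
  then have pq: "p \<noteq> q" "p \<in> V" using edge by auto
  have y: "y \<in> graph_points V E" using e(1) assms(2) by (auto simp: graph_points_def)
  note vp = vertex_point_in_edge_points[OF pq(1)]
  have "extend (\<lambda>u. real (level u)) y = real (level p) + y q"
  proof -
    have p: "y p = 1 - y q" using assms(2) by (simp add: edge_points_pair[OF pq(1)])
    show ?thesis unfolding extend_edge[OF pq(1) assms(2)] e(2) p by (simp add: algebra_simps)
  qed
  then have "real (level p) + y q \<le> d (vertex_point r) y"
    using extend_lipschitz[of "\<lambda>u. real (level u)" "vertex_point r" y] y vertex_in_points[OF r_in_V]
    by (auto simp: parent_of_def)
  moreover have "d (vertex_point p) y \<le> y q"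
    using path_dist_upper[OF path_length_edge[OF e(1) vp(1) assms(2)]]
      edge_dist_pair(2)[OF pq(1) vp(1) assms(2)] assms(2) pq(1)
    by (simp add: vertex_point_def edge_points_pair)
  then have "d (vertex_point r) y \<le> real (level p) + y q"
    using triangle[OF vertex_in_points[OF r_in_V] vertex_in_points[OF pq(2)] y] dist_root_vertex[OF pq(2)]
    by simp
  ultimately show ?thesis by simp
qed

text \<open>
  With \<open>0 < y q\<close> a vertex is assigned to the edge that joins it to its parent, and every point
  other than the root to exactly one edge.
\<close>

lemma point_cases:
  assumes "y \<in> graph_points V E" "y \<noteq> vertex_point r"
  obtains p q where "parent_of p q" "y \<in> edge_points {p, q}" "0 < y q"
proof -
  have vertex: "\<exists>w. parent_of w u \<and> y \<in> edge_points {w, u} \<and> 0 < y u"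
    if u: "u \<in> V" "y = vertex_point u" for u
  proof -
    have "u \<noteq> r" using u(2) assms(2) by auto
    then obtain w where w: "{u, w} \<in> E" "level u = Suc (level w)"
      using parent_exists[OF u(1)] by blast
    then have "parent_of w u" by (simp add: parent_of_def insert_commute)
    moreover have "w \<noteq> u" using edge[OF w(1)] by auto
    then have "y \<in> edge_points {w, u}" using vertex_point_in_edge_points(2) u(2) by metis
    moreover have "0 < y u" using u(2) by (simp add: vertex_point_def)
    ultimately show ?thesis by blast
  qed
  consider u where "u \<in> V" "y = vertex_point u" | e where "e \<in> E" "y \<in> edge_points e"
    using assms(1) by (auto simp: graph_points_def)
  then show ?thesis
  proof cases
    case 2
    obtain p q where pq: "e = {p, q}" "parent_of p q" using edge_cases[OF 2(1)] .
    then have ne: "p \<noteq> q" "p \<in> V" using edge by (auto simp: parent_of_def)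
    have y: "y \<in> edge_points {p, q}" using 2 pq by simp
    show ?thesis
    proof (cases "y q = 0")
      case True
      then have "y = vertex_point p"
        using y by (intro ext) (auto simp: edge_points_pair[OF ne(1)] vertex_point_def indicator_def)
      then show ?thesis using vertex[OF ne(2)] that by blast
    next
      case False
      then have "0 < y q" using y by (simp add: edge_points_pair[OF ne(1)])
      then show ?thesis using that pq(2) y by blast
    qed
  qed (use vertex that in blast)
qed

definition descendant :: "'a \<Rightarrow> 'a \<Rightarrow> bool" where
  "descendant = parent_of\<^sup>*\<^sup>*"

lemma dist_geodesic:
  assumes "x \<in> geodesic_segment (graph_points V E) d o' y"
  shows "d o' y = d o' x + d x y"
proof -
  obtain \<gamma> s where \<gamma>: "isometric_on (graph_points V E) d {0..d o' y} \<gamma>" "\<gamma> 0 = o'" "\<gamma> (d o' y) = y"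
    and s: "s \<in> {0..d o' y}" "\<gamma> s = x"
    using assms unfolding geodesic_segment_def by blast
  have iso: "d (\<gamma> a) (\<gamma> b) = \<bar>a - b\<bar>" if "a \<in> {0..d o' y}" "b \<in> {0..d o' y}" for a b
    using \<gamma>(1) that unfolding isometric_on_def by blast
  have "d o' x = s" using iso[of 0 s] \<gamma>(2) s by simp
  moreover have "d x y = d o' y - s" using iso[of s "d o' y"] \<gamma>(3) s by simp
  ultimately show ?thesis by simp
qed

text \<open>
  If \<open>v\<close> lies on a geodesic from the root to \<open>y\<close>, then the distance from \<open>v\<close> to \<open>y\<close> is
  the difference \<open>K\<close> of their distances to the root. A path from \<open>v\<close> to a vertex that is not
  a descendant of \<open>v\<close> starts with a step upwards, so it is longer than the difference of the
  levels by at least \<open>2\<close>. Interpolating along an edge with two such ends gives the same excess at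
  its points, so that \<open>y\<close> cannot be on such an edge.
\<close>

lemma shadow_is_below:
  assumes "v \<in> V" "0 < K" "y \<in> metric_sphere (graph_points V E) d (vertex_point r) (real (level v) + K)"
    and "y \<in> shadow (graph_points V E) d (vertex_point r) (vertex_point v)"
  obtains p q where "parent_of p q" "y \<in> edge_points {p, q}" "0 < y q"
    "real (level p) + y q = real (level v) + K" "descendant v q"
proof -
  have y: "y \<in> graph_points V E" and dy: "d (vertex_point r) y = real (level v) + K"
    using assms(3) by (auto simp: metric_sphere_def)
  have "d (vertex_point r) y = d (vertex_point r) (vertex_point v) + d (vertex_point v) y"
    using assms(4) by (intro dist_geodesic) (auto simp: shadow_def)
  then have dvy: "d (vertex_point v) y = K" using dy dist_root_vertex[OF assms(1)] by simp
  have "y \<noteq> vertex_point r" using dy assms(2) y by auto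
  then obtain p q where pq: "parent_of p q" "y \<in> edge_points {p, q}" "0 < y q"
    using point_cases[OF y] by metis
  have lev: "real (level p) + y q = real (level v) + K" using dist_root_edge_point[OF pq(1,2)] dy by simp
  have ne: "p \<noteq> q" and lq: "level q = Suc (level p)" using pq(1) edge by (auto simp: parent_of_def)
  \<comment> \<open>The only edge leading out of the descendants of \<open>v\<close> joins \<open>v\<close> to its parent, where the
    level drops by 1; so the penalty 2 keeps the change of \<open>f\<close> at 1.\<close>
  define f where "f u = real (level u) - real (level v) + (if descendant v u then 0 else 2)" for u
  have "\<bar>f a - f b\<bar> \<le> 1" if ab: "parent_of a b" for a b
  proof -
    have lb: "level b = Suc (level a)" using ab by (simp add: parent_of_def)
    have fwd: "descendant v b" if "descendant v a"
      using that ab by (simp add: descendant_def)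
    have bwd: "b = v" if "descendant v b" "\<not> descendant v a"
      using that(1) unfolding descendant_def
    proof (cases rule: rtranclp.cases)
      case (rtrancl_into_rtrancl c)
      then have "c = a" using parent_of_unique ab by blast
      then show ?thesis using that(2) rtrancl_into_rtrancl(1) by (simp add: descendant_def)
    qed simp
    show ?thesis using fwd bwd lb by (auto simp: f_def)
  qed
  then have "\<bar>extend f (vertex_point v) - extend f y\<bar> \<le> d (vertex_point v) y"
    using extend_lipschitz y vertex_in_points[OF assms(1)] by blast
  moreover have "f v = 0" by (simp add: f_def descendant_def)
  ultimately have fy: "extend f y \<le> K" using dvy by simp
  have "descendant v q"
  proof (rule ccontr)
    assume nq: "\<not> descendant v q"
    then have "\<not> descendant v p"
      using pq(1) unfolding descendant_def by (blast intro: rtranclp.rtrancl_into_rtrancl)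
    then have f: "f p = real (level p) - real (level v) + 2" "f q = f p + 1"
      using nq lq by (simp_all add: f_def)
    have p: "y p = 1 - y q" using pq(2) by (simp add: edge_points_pair[OF ne])
    have "extend f y = f p + y q"
      unfolding extend_edge[OF ne pq(2)] f(2) p by (simp add: algebra_simps)
    then show False using fy lev f(1) by simp
  qed
  then show ?thesis by (rule that[OF pq lev])
qed

text \<open>
  Move the two points of the sphere down to the lower ends of their edges, which rounds their
  distance \<open>level v + K\<close> to the root up to \<open>level v + \<lceil>K\<rceil>\<close>. The ends are distinct, because the
  lower end determines the edge and the distance to the root determines the point on the edge.
\<close>

lemma two_descendants:
  assumes "K_pseudo_regular K V E r" "v \<in> V"
  shows "\<exists>x y. x \<noteq> y \<and> descendant v x \<and> descendant v y \<and>
    level x = level v + nat \<lceil>K\<rceil> \<and> level y = level v + nat \<lceil>K\<rceil>"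
proof -
  have K: "0 < K" using assms(1) by (simp add: K_pseudo_regular_def)
  let ?o = "vertex_point r" and ?a = "vertex_point v" and ?T = "graph_points V E"
  have "?a \<in> metric_sphere ?T d ?o (real (level v))"
    using dist_root_vertex vertex_in_points assms(2) by (simp add: metric_sphere_def)
  then obtain y z where yz: "y \<noteq> z"
    "y \<in> metric_sphere ?T d ?o (real (level v) + K)" "y \<in> shadow ?T d ?o ?a"
    "z \<in> metric_sphere ?T d ?o (real (level v) + K)" "z \<in> shadow ?T d ?o ?a"
    using assms(1) unfolding K_pseudo_regular_def Let_def by blast
  obtain p q where pq: "parent_of p q" "y \<in> edge_points {p, q}" "0 < y q"
    "real (level p) + y q = real (level v) + K" "descendant v q"
    using shadow_is_below[OF assms(2) K yz(2,3)] .
  obtain p' q' where pq': "parent_of p' q'" "z \<in> edge_points {p', q'}" "0 < z q'"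
    "real (level p') + z q' = real (level v) + K" "descendant v q'"
    using shadow_is_below[OF assms(2) K yz(4,5)] .
  have level: "level b = level v + nat \<lceil>K\<rceil>"
    if "parent_of a b" "x \<in> edge_points {a, b}" "0 < x b" "real (level a) + x b = real (level v) + K"
    for a b x
  proof -
    have "a \<noteq> b" and b: "level b = Suc (level a)" using that(1) edge by (auto simp: parent_of_def)
    then have "x b \<le> 1" using that(2) by (simp add: edge_points_pair)
    then have "\<lceil>K\<rceil> = int (level b) - int (level v)" using that(3,4) b by (intro ceiling_unique) auto
    moreover have "0 < \<lceil>K\<rceil>" using K by simp
    ultimately show ?thesis by linarith
  qed
  have "q \<noteq> q'"
  proof
    assume "q = q'"
    then have "p = p'" using pq(1) pq'(1) parent_of_unique by blast
    have "p \<noteq> q" using pq(1) edge by (auto simp: parent_of_def)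
    have "y q = z q" using pq(4) pq'(4) \<open>q = q'\<close> \<open>p = p'\<close> by simp
    have "z \<in> edge_points {p, q}" using pq'(2) \<open>q = q'\<close> \<open>p = p'\<close> by simp
    then have "y p = z p" "u \<noteq> p \<Longrightarrow> u \<noteq> q \<Longrightarrow> y u = z u" for u
      using pq(2) \<open>y q = z q\<close> unfolding edge_points_pair[OF \<open>p \<noteq> q\<close>] by auto
    then have "y u = z u" for u using \<open>y q = z q\<close> by (cases "u = p \<or> u = q") auto
    then show False using yz(1) by auto
  qed
  moreover have "level q = level v + nat \<lceil>K\<rceil>" "level q' = level v + nat \<lceil>K\<rceil>"
    using level[OF pq(1-4)] level[OF pq'(1-4)] by auto
  ultimately show ?thesis using pq(5) pq'(5) by blast
qed

end

section \<open>Coordinates on the vertices of a pseudo-regular tree\<close>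

text \<open>
  The map \<open>h\<close> is bilipschitz for the word metric, stated without that metric: the second part
  bounds distances in the tree by distances of words, the third part conversely, where
  adjacent vertices are enough.
\<close>

definition word_coordinates :: "nat \<Rightarrow> 'a set \<Rightarrow> 'a set set \<Rightarrow> (bool list \<times> nat \<Rightarrow> 'a) \<Rightarrow> bool" where
  "word_coordinates L V E h \<longleftrightarrow> bij_betw h (UNIV \<times> {..<L}) V \<and>
     (\<exists>C. \<forall>k w w' i j. i < L \<longrightarrow> j < L \<longrightarrow> (w, w') \<in> word_rel ^^ k \<longrightarrow>
        path_dist E (vertex_point (h (w, i))) (vertex_point (h (w', j))) \<le> real (Suc k) * C) \<and>
     (\<exists>N. \<forall>w w' i j. i < L \<longrightarrow> j < L \<longrightarrow> {h (w, i), h (w', j)} \<in> E \<longrightarrow> (w, w') \<in> word_rel ^^ N)"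

context tree_with_root
begin

lemma children_lists:
  assumes "bounded_degree V E"
  shows "\<exists>ch m. \<forall>u. set (ch u) = {w. parent_of u w} \<and> distinct (ch u) \<and> length (ch u) \<le> m"
proof -
  obtain \<mu> :: real where \<mu>: "\<And>v. v \<in> V \<Longrightarrow> finite {e\<in>E. v \<in> e} \<and> real (card {e\<in>E. v \<in> e}) \<le> \<mu>"
    using assms unfolding bounded_degree_def by blast
  have "\<exists>xs. set xs = {w. parent_of u w} \<and> distinct xs \<and> length xs \<le> nat \<lfloor>\<mu>\<rfloor>" for u
  proof (cases "u \<in> V")
    case True
    have sub: "(\<lambda>w. {u, w}) ` {w. parent_of u w} \<subseteq> {e\<in>E. u \<in> e}"
      by (auto simp: parent_of_def)
    have inj: "inj_on (\<lambda>w. {u, w}) {w. parent_of u w}"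
      by (auto simp: inj_on_def doubleton_eq_iff)
    have fin: "finite {w. parent_of u w}"
      using \<mu>[OF True] sub inj by (metis finite_imageD finite_subset)
    have "card {w. parent_of u w} \<le> card {e\<in>E. u \<in> e}"
      using card_mono[OF _ sub] \<mu>[OF True] card_image[OF inj] by simp
    then have "card {w. parent_of u w} \<le> nat \<lfloor>\<mu>\<rfloor>"
      using \<mu>[OF True] by linarith
    moreover obtain xs where "set xs = {w. parent_of u w}" "distinct xs"
      using finite_distinct_list[OF fin] by blast
    ultimately show ?thesis using distinct_card by metis
  next
    case False
    then have "{w. parent_of u w} = {}" using edge by (auto simp: parent_of_def)
    then show ?thesis by auto
  qed
  then show ?thesis by metis
qed

lemma vertex_metric: "Metric_space V (\<lambda>u v. d (vertex_point u) (vertex_point v))"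
proof -
  interpret Metric_space "graph_points V E" d
    by (rule Metric_space_path_dist[OF simple connected])
  show ?thesis
    by unfold_locales
      (use nonneg commute triangle zero vertex_in_points inj_vertex_point in \<open>auto dest: injD\<close>)
qed

lemma edge_length: "{u, v} \<in> E \<Longrightarrow> d (vertex_point u) (vertex_point v) \<le> 1"
  using path_dist_upper[OF path_length_walk[OF simple, of "[u, v]"]] edge by (auto simp: walk_def)

lemma descendants_of_root: "descendant r v \<longleftrightarrow> v \<in> V"
proof
  assume "descendant r v"
  then show "v \<in> V"
    unfolding descendant_def by (induction) (use r_in_V edge in \<open>auto simp: parent_of_def\<close>)
next
  assume "v \<in> V"
  then show "descendant r v"
  proof (induction "level v" arbitrary: v rule: less_induct)
    case less
    show ?case
    proof (cases "v = r")
      case False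
      then obtain w where w: "{v, w} \<in> E" "level v = Suc (level w)"
        using parent_exists[OF less.prems] by blast
      then have "descendant r w" using less.hyps[of w] edge[OF w(1)] by simp
      moreover have "parent_of w v" using w by (simp add: parent_of_def insert_commute)
      ultimately show ?thesis unfolding descendant_def by (rule rtranclp.rtrancl_into_rtrancl)
    qed (simp add: descendant_def)
  qed
qed

theorem word_coordinates_exist:
  assumes "bounded_degree V E" "K_pseudo_regular K V E r" "nat \<lceil>K\<rceil> \<le> L" "0 < L"
  shows "\<exists>h. word_coordinates L V E h"
proof -
  obtain ch m where ch: "\<And>u. set (ch u) = {w. parent_of u w}" "\<And>u. distinct (ch u)"
    "\<And>u. length (ch u) \<le> m"
    using children_lists[OF assms(1)] by metis
  have "child_rel ch = {(u, w). parent_of u w}" by (simp add: child_rel_def ch(1))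
  then have desc: "(u, w) \<in> (child_rel ch)\<^sup>* \<longleftrightarrow> descendant u w" for u w
    by (simp add: descendant_def rtranclp_rtrancl_eq)
  interpret ramified_tree r ch level m "nat \<lceil>K\<rceil>"
  proof
    fix v assume "(r, v) \<in> (child_rel ch)\<^sup>*"
    then show "\<exists>x y. x \<noteq> y \<and> (v, x) \<in> (child_rel ch)\<^sup>* \<and> (v, y) \<in> (child_rel ch)\<^sup>* \<and>
      level x = level v + nat \<lceil>K\<rceil> \<and> level y = level v + nat \<lceil>K\<rceil>"
      using two_descendants[OF assms(2)] descendants_of_root unfolding desc by blast
  qed (use ch parent_of_unique in \<open>auto simp: parent_of_def\<close>)
  have V: "below r = V" unfolding below_def desc descendants_of_root by simp
  define h where "h = place L"
  define d' where "d' u v = d (vertex_point u) (vertex_point v)" for u v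
  have metric: "Metric_space (below r) d'" unfolding V d'_def by (rule vertex_metric)
  have child: "d' u v \<le> 1" if "v \<in> set (ch u)" for u v
    using that edge_length by (simp add: ch(1) d'_def parent_of_def)
  have bij: "bij_betw h (UNIV \<times> {..<L}) V"
    using bij_betw_place[OF assms(3,4)] unfolding h_def V .
  have down: "(w, w') \<in> word_rel ^^ (1 + L * m)"
    if ij: "i < L" "j < L" and p: "parent_of (h (w, i)) (h (w', j))" for w w' i j
  proof -
    obtain w'' j' where w'': "j' < L" "h (w'', j') = h (w', j)" "(w, w'') \<in> word_rel ^^ (1 + L * m)"
      using place_child[OF assms(3,4) ij(1), of "h (w', j)" w] p ch(1) unfolding h_def by blast
    then have "(w'', j') = (w', j)"
      using bij_betw_imp_inj_on[OF bij] ij(2) by (auto dest: inj_onD)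
    then show ?thesis using w''(3) by simp
  qed
  have "(w, w') \<in> word_rel ^^ (1 + L * m)"
    if "i < L" "j < L" "{h (w, i), h (w', j)} \<in> E" for w w' i j
  proof -
    have "parent_of (h (w, i)) (h (w', j)) \<or> parent_of (h (w', j)) (h (w, i))"
      using edge_levels[OF that(3)] that(3) by (simp add: parent_of_def insert_commute)
    then show ?thesis using down that(1,2) symD[OF sym_word_rel] by metis
  qed
  moreover have "d' (h (w, i)) (h (w', j)) \<le> real (Suc k) * (4 * real L)"
    if "i < L" "j < L" "(w, w') \<in> word_rel ^^ k" for k w w' i j
    using d_place_relpow[OF assms(3,4) metric child that(3,1,2)] unfolding h_def by simp
  ultimately show ?thesis using bij unfolding word_coordinates_def d'_def by blast
qed

text \<open>The distance of two vertices is the length of a walk, along which the bound adds up.\<close>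

lemma lipschitz_of_edges:
  assumes "Metric_space M \<delta>" "f ` V \<subseteq> M"
    and "\<And>u v. {u, v} \<in> E \<Longrightarrow> \<delta> (f u) (f v) \<le> C"
    and "u \<in> V" "v \<in> V"
  shows "\<delta> (f u) (f v) \<le> C * d (vertex_point u) (vertex_point v)"
proof -
  interpret Metric_space M \<delta> by (rule assms(1))
  have walk: "\<delta> (f (hd p)) (f (last p)) \<le> C * real (length p - 1)" if "walk V E p" for p
    using that
  proof (induction p)
    case (Cons a p)
    show ?case
    proof (cases p)
      case Nil
      then show ?thesis using Cons.prems assms(2) by (auto simp: walk_def)
    next
      case p: (Cons b q)
      then have w: "{a, b} \<in> E" "walk V E p" using Cons.prems by (auto simp: walk_def)
      have "last p \<in> V" using w(2) last_in_set[of p] by (auto simp: walk_def)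
      then have "f a \<in> M" "f b \<in> M" "f (last p) \<in> M"
        using assms(2) edge[OF w(1)] by auto
      then have "\<delta> (f a) (f (last p)) \<le> \<delta> (f a) (f b) + \<delta> (f b) (f (last p))" by (rule triangle)
      then show ?thesis using Cons.IH[OF w(2)] assms(3)[OF w(1)] p by (simp add: algebra_simps)
    qed
  qed (simp add: walk_def)
  define P where "P n \<longleftrightarrow> (\<exists>p. walk V E p \<and> hd p = u \<and> last p = v \<and> length p = Suc n)" for n
  obtain p where p: "walk V E p" "hd p = u" "last p = v"
    using connected assms(4,5) unfolding connected_graph_def by blast
  then have "P (length p - 1)" unfolding P_def by (intro exI[of _ p]) (auto simp: walk_def)
  then have "P (LEAST n. P n)" by (rule LeastI)
  moreover have "d (vertex_point u) (vertex_point v) = real (LEAST n. P n)"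
    unfolding P_def by (rule path_dist_vertex_point[OF simple connected assms(4,5)])
  ultimately show ?thesis using walk unfolding P_def by fastforce
qed

end

text \<open>
  An edge of the first tree moves the word by at most \<open>N\<close> letters, which moves the image in the
  second tree by a bounded distance. Used in both directions, this gives the two inequalities of
  the theorem.
\<close>

lemma coordinates_lipschitz:
  fixes V\<^sub>X :: "'a set" and V\<^sub>Y :: "'b set"
  assumes "rooted_tree V\<^sub>X E\<^sub>X x\<^sub>0" "rooted_tree V\<^sub>Y E\<^sub>Y y\<^sub>0"
    and X: "word_coordinates L V\<^sub>X E\<^sub>X h\<^sub>X" and Y: "word_coordinates L V\<^sub>Y E\<^sub>Y h\<^sub>Y"
  shows "\<exists>C. \<forall>p \<in> UNIV \<times> {..<L}. \<forall>q \<in> UNIV \<times> {..<L}.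
    path_dist E\<^sub>Y (vertex_point (h\<^sub>Y p)) (vertex_point (h\<^sub>Y q)) \<le>
      C * path_dist E\<^sub>X (vertex_point (h\<^sub>X p)) (vertex_point (h\<^sub>X q))"
proof -
  let ?M = "UNIV \<times> {..<L} :: (bool list \<times> nat) set"
  interpret X: tree_with_root V\<^sub>X E\<^sub>X x\<^sub>0 by unfold_locales (rule assms(1))
  interpret Y: tree_with_root V\<^sub>Y E\<^sub>Y y\<^sub>0 by unfold_locales (rule assms(2))
  have bX: "bij_betw h\<^sub>X ?M V\<^sub>X" and bY: "bij_betw h\<^sub>Y ?M V\<^sub>Y"
    using X Y unfolding word_coordinates_def by blast+
  obtain N where N: "\<And>w w' i j. i < L \<Longrightarrow> j < L \<Longrightarrow> {h\<^sub>X (w, i), h\<^sub>X (w', j)} \<in> E\<^sub>X \<Longrightarrow>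
      (w, w') \<in> word_rel ^^ N"
    using X unfolding word_coordinates_def by blast
  obtain C where C: "\<And>k w w' i j. i < L \<Longrightarrow> j < L \<Longrightarrow> (w, w') \<in> word_rel ^^ k \<Longrightarrow>
      path_dist E\<^sub>Y (vertex_point (h\<^sub>Y (w, i))) (vertex_point (h\<^sub>Y (w', j))) \<le> real (Suc k) * C"
    using Y unfolding word_coordinates_def by blast
  define f where "f u = h\<^sub>Y (the_inv_into ?M h\<^sub>X u)" for u
  have inv: "the_inv_into ?M h\<^sub>X (h\<^sub>X p) = p" if "p \<in> ?M" for p
    using that the_inv_into_f_f bij_betw_imp_inj_on[OF bX] by metis
  have fV: "f ` V\<^sub>X \<subseteq> V\<^sub>Y"
    using inv bX bY by (auto simp: f_def bij_betw_def)
  have "path_dist E\<^sub>Y (vertex_point (f u)) (vertex_point (f v)) \<le> real (Suc N) * C"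
    if e: "{u, v} \<in> E\<^sub>X" for u v
  proof -
    obtain p q where pq: "p \<in> ?M" "u = h\<^sub>X p" "q \<in> ?M" "v = h\<^sub>X q"
      using X.edge[OF e] bX by (auto simp: bij_betw_def)
    then show ?thesis
      using N[of "snd p" "snd q" "fst p" "fst q"] C[of "snd p" "snd q" "fst p" "fst q" N] e
      by (auto simp: f_def inv)
  qed
  then have "path_dist E\<^sub>Y (vertex_point (f u)) (vertex_point (f v)) \<le>
      real (Suc N) * C * path_dist E\<^sub>X (vertex_point u) (vertex_point v)"
    if "u \<in> V\<^sub>X" "v \<in> V\<^sub>X" for u v
    using X.lipschitz_of_edges[OF Y.vertex_metric fV] that by blast
  then have "path_dist E\<^sub>Y (vertex_point (f (h\<^sub>X p))) (vertex_point (f (h\<^sub>X q))) \<le>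
      real (Suc N) * C * path_dist E\<^sub>X (vertex_point (h\<^sub>X p)) (vertex_point (h\<^sub>X q))"
    if "p \<in> ?M" "q \<in> ?M" for p q
    using that bij_betwE[OF bX] by blast
  then show ?thesis unfolding f_def using inv by metis
qed

theorem corollary1p2:
  fixes V\<^sub>X :: "'a set" and E\<^sub>X :: "'a set set" and x\<^sub>0 :: 'a
    and V\<^sub>Y :: "'b set" and E\<^sub>Y :: "'b set set" and y\<^sub>0 :: 'b
  assumes "rooted_tree V\<^sub>X E\<^sub>X x\<^sub>0" and "visual V\<^sub>X E\<^sub>X x\<^sub>0"
    and "pseudo_regular V\<^sub>X E\<^sub>X x\<^sub>0" and "bounded_degree V\<^sub>X E\<^sub>X"
    and "rooted_tree V\<^sub>Y E\<^sub>Y y\<^sub>0" and "visual V\<^sub>Y E\<^sub>Y y\<^sub>0"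
    and "pseudo_regular V\<^sub>Y E\<^sub>Y y\<^sub>0" and "bounded_degree V\<^sub>Y E\<^sub>Y"
  shows "bilipschitz_equivalent (vertex_point ` V\<^sub>X) (path_dist E\<^sub>X)
                                (vertex_point ` V\<^sub>Y) (path_dist E\<^sub>Y)"
proof -
  interpret X: tree_with_root V\<^sub>X E\<^sub>X x\<^sub>0 by unfold_locales (rule assms(1))
  interpret Y: tree_with_root V\<^sub>Y E\<^sub>Y y\<^sub>0 by unfold_locales (rule assms(5))
  obtain K\<^sub>X K\<^sub>Y where K: "K_pseudo_regular K\<^sub>X V\<^sub>X E\<^sub>X x\<^sub>0" "K_pseudo_regular K\<^sub>Y V\<^sub>Y E\<^sub>Y y\<^sub>0"
    using assms(3,7) unfolding pseudo_regular_def by blast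
  define L where "L = Suc (max (nat \<lceil>K\<^sub>X\<rceil>) (nat \<lceil>K\<^sub>Y\<rceil>))"
  have L: "nat \<lceil>K\<^sub>X\<rceil> \<le> L" "nat \<lceil>K\<^sub>Y\<rceil> \<le> L" "0 < L"
    unfolding L_def by (rule le_SucI[OF max.cobounded1], rule le_SucI[OF max.cobounded2], rule zero_less_Suc)
  let ?M = "UNIV \<times> {..<L} :: (bool list \<times> nat) set"
  obtain h\<^sub>X where hX: "word_coordinates L V\<^sub>X E\<^sub>X h\<^sub>X"
    using X.word_coordinates_exist[OF assms(4) K(1) L(1,3)] ..
  obtain h\<^sub>Y where hY: "word_coordinates L V\<^sub>Y E\<^sub>Y h\<^sub>Y"
    using Y.word_coordinates_exist[OF assms(8) K(2) L(2,3)] ..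
  define k\<^sub>X k\<^sub>Y where "k\<^sub>X = vertex_point \<circ> h\<^sub>X" and "k\<^sub>Y = vertex_point \<circ> h\<^sub>Y"
  have kX: "bij_betw k\<^sub>X ?M (vertex_point ` V\<^sub>X)" and kY: "bij_betw k\<^sub>Y ?M (vertex_point ` V\<^sub>Y)"
    using hX hY unfolding word_coordinates_def k\<^sub>X_def k\<^sub>Y_def
    by (meson bij_betw_trans inj_imp_bij_betw_inv inj_on_imp_bij_betw inj_vertex_point inj_on_subset subset_UNIV)+
  obtain A where A: "\<And>p q. p \<in> ?M \<Longrightarrow> q \<in> ?M \<Longrightarrow>
      path_dist E\<^sub>Y (k\<^sub>Y p) (k\<^sub>Y q) \<le> A * path_dist E\<^sub>X (k\<^sub>X p) (k\<^sub>X q)"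
    using coordinates_lipschitz[OF assms(1,5) hX hY] unfolding k\<^sub>X_def k\<^sub>Y_def comp_def by blast
  obtain B where B: "\<And>p q. p \<in> ?M \<Longrightarrow> q \<in> ?M \<Longrightarrow>
      path_dist E\<^sub>X (k\<^sub>X p) (k\<^sub>X q) \<le> B * path_dist E\<^sub>Y (k\<^sub>Y p) (k\<^sub>Y q)"
    using coordinates_lipschitz[OF assms(5,1) hY hX] unfolding k\<^sub>X_def k\<^sub>Y_def comp_def by blast
  define C where "C = 1 + \<bar>A\<bar> + \<bar>B\<bar>"
  have C: "0 < C" "A \<le> C" "B \<le> C" by (auto simp: C_def)
  define g where "g = k\<^sub>Y \<circ> the_inv_into ?M k\<^sub>X"
  have "bij_betw g (vertex_point ` V\<^sub>X) (vertex_point ` V\<^sub>Y)"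
    unfolding g_def using bij_betw_trans[OF bij_betw_the_inv_into[OF kX] kY] .
  moreover have "1 / C * path_dist E\<^sub>X x x' \<le> path_dist E\<^sub>Y (g x) (g x') \<and>
      path_dist E\<^sub>Y (g x) (g x') \<le> C * path_dist E\<^sub>X x x'"
    if xx': "x \<in> vertex_point ` V\<^sub>X" "x' \<in> vertex_point ` V\<^sub>X" for x x'
  proof -
    obtain p q where pq: "p \<in> ?M" "x = k\<^sub>X p" "q \<in> ?M" "x' = k\<^sub>X q"
      using xx' unfolding bij_betw_imp_surj_on[OF kX, symmetric] by blast
    then have g: "g x = k\<^sub>Y p" "g x' = k\<^sub>Y q"
      using the_inv_into_f_f[OF bij_betw_imp_inj_on[OF kX]] by (auto simp: g_def)
    have nonneg: "0 \<le> path_dist E\<^sub>X x x'" "0 \<le> path_dist E\<^sub>Y (g x) (g x')"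
      using Metric_space.nonneg[OF Metric_space_path_dist] X.simple X.connected Y.simple Y.connected
      by blast+
    have "path_dist E\<^sub>Y (g x) (g x') \<le> C * path_dist E\<^sub>X x x'"
      using A[OF pq(1,3)] mult_right_mono[OF C(2) nonneg(1)] unfolding g unfolding pq by linarith
    moreover have "path_dist E\<^sub>X x x' \<le> C * path_dist E\<^sub>Y (g x) (g x')"
      using B[OF pq(1,3)] mult_right_mono[OF C(3) nonneg(2)] unfolding g unfolding pq by linarith
    ultimately show ?thesis using C(1) by (simp add: field_simps)
  qed
  ultimately show ?thesis using C(1) unfolding bilipschitz_equivalent_def by blast
qed

end
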